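(* Let $D$ be a $t$-partite degree matrix and let $\rho_D=\rho(T_D)$. (a) For every $\varepsilon>0$ there exists an integer $r=r(D,\varepsilon)$ such that for every integer $k\ge1$ and every finite graph $G$, if $D$ is a subdegree matrix of $G$ and $\alpha_{2r+1}(G)\ge k$, then $\lambda_k(G)\ge\rho_D-\varepsilon$. (b) For every $\varepsilon>0$ and every positive integer $\Delta$ there exists a constant $c=c(D,\Delta,\varepsilon)>0$ such that every graph $G$ of order $n$ with maximum degree at most $\Delta$ and with subdegree matrix $D$ has at least $cn$ eigenvalues that are larger than $\rho_D-\varepsilon$.
   Context: A $t$-partite degree matrix ($t\ge1$) is a square matrix $D=[d_{ij}]_{i,j=1}^t$ with non-negative integer entries satisfying: (D1) if $d_{ij}=0$ then $d_{ji}=0$; (D2) for all $i,k$ there are $m_1=i,\dots,m_s=k$ with $d_{m_jm_{j+1}}>0$ for all $j$; (D3) for every sequence of distinct $m_1,\dots,m_s$, $d_{m_1m_2}\cdots d_{m_{s-1}m_s}d_{m_sm_1}=d_{m_1m_s}d_{m_sm_{s-1}}\cdots d_{m_2m_1}$. $D$ is a degree matrix for a graph $H$ if $V(H)$ has a partition $U_1\cup\cdots\cup U_t$ with every vertex in $U_i$ having exactly $d_{ij}$ neighbors in $U_j$. $T_D$ (the universal cover) is the unique up to isomorphism tree with degree matrix $D$. $D$ is a subdegree matrix for $G$ if there is a graph homomorphism $\pi:T_D\to G$ that is locally 1-1 (for each vertex $x$ of $T_D$, the edges at $x$ are mapped injectively to edges at $\pi(x)$). For a graph $H$ and vertex $v$,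 $H_r(v)$ is the induced subgraph on vertices at distance at most $r$ from $v$. For a finite graph, $\rho$ is its largest adjacency eigenvalue; for a connected infinite locally finite graph $H$, $\rho(H)=\lim_{r\to\infty}\rho(H_r(v))$ for any vertex $v$ (independent of $v$). $\lambda_k(G)$ is the $k$-th largest adjacency eigenvalue of $G$ counted with multiplicity. A vertex set is $r$-apart if any two of its vertices are at distance at least $r+1$; $\alpha_r(G)$ is the maximum size of an $r$-apart vertex set in $G$.
   Formalization: "Subdegree matrix" here also requires every vertex of G to lie in the image of some locally 1-1 homomorphism from T_D; with mere existence of one such map the claim fails, e.g. D=[3] and K_4 with a long path attached. *)

theory Defs
  imports
    "Graph_Theory.Digraph_Component"
    "Graph_Theory.Shortest_Path"
    "Jordan_Normal_Form.Char_Poly"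
begin

section \<open>Graphs, distances and balls\<close>

text \<open>
  A simple graph is a symmetric digraph without loops and parallel arcs. The library predicate
  \<^const>\<open>graph\<close> is its finite version; the following one also admits infinite graphs.
\<close>
definition simple_graph :: "('v, 'e) pre_digraph \<Rightarrow> bool" where
  "simple_graph G \<longleftrightarrow> sym_digraph G \<and> loopfree_digraph G \<and> nomulti_digraph G"

definition neighbors :: "('v, 'e) pre_digraph \<Rightarrow> 'v \<Rightarrow> 'v set" where
  "neighbors G v = {w. v \<rightarrow>\<^bsub>G\<^esub> w}"

text \<open>Vertices in different components are at distance \<open>\<infinity>\<close>.\<close>
definition distance :: "('v, 'e) pre_digraph \<Rightarrow> 'v \<Rightarrow> 'v \<Rightarrow> ereal" where
  "distance G u v = wf_digraph.\<mu> G (\<lambda>_. 1) u v"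

definition ball_graph :: "('v, 'e) pre_digraph \<Rightarrow> nat \<Rightarrow> 'v \<Rightarrow> ('v, 'e) pre_digraph" where
  "ball_graph H r v = H \<restriction> {u \<in> verts H. distance H v u \<le> ereal (real r)}"

definition apart :: "nat \<Rightarrow> ('v, 'e) pre_digraph \<Rightarrow> 'v set \<Rightarrow> bool" where
  "apart r G S \<longleftrightarrow> S \<subseteq> verts G \<and>
     (\<forall>u\<in>S. \<forall>v\<in>S. u \<noteq> v \<longrightarrow> distance G u v \<ge> ereal (real (r + 1)))"

definition apart_number :: "nat \<Rightarrow> ('v, 'e) pre_digraph \<Rightarrow> nat" where
  "apart_number r G = Max {card S | S. apart r G S}"

text \<open>
  The library predicates \<^const>\<open>forest\<close> and \<^const>\<open>tree\<close> are unsuitable for symmetric digraphs: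
  they regard the closed walk \<open>a, b, a\<close> along a single edge as a cycle. In a simple graph, the
  undirected cycles are the directed ones of length at least \<open>3\<close>.
\<close>
definition is_tree :: "('v, 'e) pre_digraph \<Rightarrow> bool" where
  "is_tree T \<longleftrightarrow> simple_graph T \<and> connected T \<and>
     \<not> (\<exists>p. pre_digraph.cycle T p \<and> length p \<ge> 3)"


section \<open>Spectra\<close>

text \<open>
  The vertices are listed in an arbitrary order; the eigenvalues and their multiplicities do not
  depend on it.
\<close>
definition vertex_list :: "('v, 'e) pre_digraph \<Rightarrow> 'v list" where
  "vertex_list G = (SOME vs. distinct vs \<and> set vs = verts G)"

definition adjacency_mat :: "('v, 'e) pre_digraph \<Rightarrow> real mat" where
  "adjacency_mat G =
     mat (card (verts G)) (card (verts G))
       (\<lambda>(i, j). if vertex_list G ! i \<rightarrow>\<^bsub>G\<^esub> vertex_list G ! j then 1 else 0)"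

text \<open>All eigenvalues of a finite graph are real, so this multiset has \<open>card (verts G)\<close> elements.\<close>
definition graph_eigenvalues :: "('v, 'e) pre_digraph \<Rightarrow> real multiset" where
  "graph_eigenvalues G = proots (char_poly (adjacency_mat G))"

text \<open>The \<open>k\<close>-th largest eigenvalue, for \<open>1 \<le> k \<le> card (verts G)\<close>.\<close>
definition kth_eigenvalue :: "nat \<Rightarrow> ('v, 'e) pre_digraph \<Rightarrow> real" where
  "kth_eigenvalue k G = rev (sorted_list_of_multiset (graph_eigenvalues G)) ! (k - 1)"

definition largest_eigenvalue :: "('v, 'e) pre_digraph \<Rightarrow> real" where
  "largest_eigenvalue G = Max {x. eigenvalue (adjacency_mat G) x}"

text \<open>In the infinite case the limit does not depend on the chosen vertex.\<close>
definition graph_rho :: "('v, 'e) pre_digraph \<Rightarrow> real" where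
  "graph_rho H =
     (if finite (verts H) then largest_eigenvalue H
      else lim (\<lambda>r. largest_eigenvalue (ball_graph H r (SOME v. v \<in> verts H))))"


section \<open>Degree matrices and universal covers\<close>

text \<open>Indices are shifted: rows and columns are numbered from \<open>0\<close> to \<open>t - 1\<close>.\<close>
definition degree_matrix :: "nat \<Rightarrow> nat mat \<Rightarrow> bool" where
  "degree_matrix t D \<longleftrightarrow> t \<ge> 1 \<and> D \<in> carrier_mat t t \<and>
     (\<forall>i<t. \<forall>j<t. D $$ (i, j) = 0 \<longrightarrow> D $$ (j, i) = 0) \<and>
     (\<forall>i<t. \<forall>k<t. \<exists>ms. ms \<noteq> [] \<and> set ms \<subseteq> {..<t} \<and> hd ms = i \<and> last ms = k \<and>
        (\<forall>j. j + 1 < length ms \<longrightarrow> D $$ (ms ! j, ms ! (j + 1)) > 0)) \<and>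
     (\<forall>ms. ms \<noteq> [] \<and> distinct ms \<and> set ms \<subseteq> {..<t} \<longrightarrow>
        (\<Prod>j<length ms. D $$ (ms ! j, ms ! ((j + 1) mod length ms))) =
        (\<Prod>j<length ms. D $$ (ms ! ((j + 1) mod length ms), ms ! j)))"

definition degree_matrix_of :: "nat mat \<Rightarrow> ('v, 'e) pre_digraph \<Rightarrow> bool" where
  "degree_matrix_of D H \<longleftrightarrow>
     (\<exists>U :: nat \<Rightarrow> 'v set.
        (\<Union>i<dim_row D. U i) = verts H \<and>
        (\<forall>i<dim_row D. U i \<noteq> {}) \<and>
        (\<forall>i<dim_row D. \<forall>j<dim_row D. i \<noteq> j \<longrightarrow> U i \<inter> U j = {}) \<and>
        (\<forall>i<dim_row D. \<forall>j<dim_row D. \<forall>v\<in>U i.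
           finite (neighbors H v \<inter> U j) \<and> card (neighbors H v \<inter> U j) = D $$ (i, j)))"

text \<open>
  The tree with degree matrix \<open>D\<close> is unique up to isomorphism and countable, so a representative
  can be chosen with natural numbers as vertices.
\<close>
definition universal_cover :: "nat mat \<Rightarrow> (nat, nat \<times> nat) pre_digraph" where
  "universal_cover D = (SOME T. is_tree T \<and> degree_matrix_of D T)"

definition locally_injective_hom ::
  "('v, 'e) pre_digraph \<Rightarrow> ('w, 'f) pre_digraph \<Rightarrow> ('v \<Rightarrow> 'w) \<Rightarrow> bool" where
  "locally_injective_hom T G \<pi> \<longleftrightarrow>
     (\<forall>x\<in>verts T. \<pi> x \<in> verts G) \<and>
     (\<forall>x y. x \<rightarrow>\<^bsub>T\<^esub> y \<longrightarrow> \<pi> x \<rightarrow>\<^bsub>G\<^esub> \<pi> y) \<and>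
     (\<forall>x\<in>verts T. inj_on \<pi> (neighbors T x))"

text \<open>
  The source definition asks only for one locally 1-1 homomorphism from the universal cover to
  \<open>G\<close> (first conjunct). We also require every vertex of \<open>G\<close> to lie in the image of such a
  homomorphism, since otherwise nothing is said about the vertices far from the image and the
  eigenvalue bounds fail: the complete graph on \<open>4\<close> vertices with a long
  pendant path attached admits a locally 1-1 homomorphism from the \<open>3\<close>-regular tree, but only its
  at most \<open>4\<close> largest eigenvalues can exceed \<open>2\<close>, whereas the \<open>3\<close>-regular tree has
  \<open>\<rho> = 2 * sqrt 2\<close>. Several homomorphisms may be used, so that \<open>G\<close> need not be connected. For
  \<open>t = 1\<close> and \<open>D = (d)\<close>, the condition says that \<open>G\<close> is nonempty with minimum degree at least \<open>d\<close>.
\<close>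
definition subdegree_matrix :: "nat mat \<Rightarrow> ('v, 'e) pre_digraph \<Rightarrow> bool" where
  "subdegree_matrix D G \<longleftrightarrow>
     (\<exists>\<pi>. locally_injective_hom (universal_cover D) G \<pi>) \<and>
     (\<forall>v\<in>verts G. \<exists>\<pi>. locally_injective_hom (universal_cover D) G \<pi> \<and>
        v \<in> \<pi> ` verts (universal_cover D))"

end

theory Submission
  imports
    Defs
    "HOL-Analysis.L2_Norm"
begin

text \<open>
  Some function \<open>f\<close> with finite support around a fixed vertex of the universal cover \<open>T\<close> has Rayleigh
  quotient at least \<open>\<rho> - \<epsilon>\<close>. Every vertex of \<open>T\<close> is at bounded distance from one of the same type as
  the fixed vertex, and the ball carrying \<open>f\<close> can be copied there. For a locally injective
  homomorphism \<open>\<pi>\<close> from \<open>T\<close> to \<open>G\<close>, the function with square \<open>w \<mapsto> (\<Sum>x\<in>\<pi>\<inverse>(w). f(x)\<^sup>2)\<close> on \<open>G\<close> has the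
  same norm as \<open>f\<close> and, by the Cauchy-Schwarz inequality, no smaller quadratic form. So every vertex
  of \<open>G\<close> has such a test function within some distance \<open>r\<close> of it, where \<open>r\<close> does not depend on \<open>G\<close>.
  Vertices that are \<open>(2r + 1)\<close>-apart have test functions with disjoint, non-adjacent supports; these
  span a space on which the quadratic form is at least \<open>\<rho> - \<epsilon>\<close>, and the min-max principle gives the
  first claim. In the second one, a maximal \<open>(2r + 1)\<close>-apart set has at least
  \<open>n / (\<Delta> + 1)\<^bsup>2r + 1\<^esup>\<close> elements, because the balls of radius \<open>2r + 1\<close> about it cover \<open>G\<close>.
\<close>

section \<open>Diagonalization of real symmetric matrices\<close>

text \<open>The fibrewise Euclidean norm answers a lack of injectivity: \<open>\<pi>\<close> may
  fold a ball of the tree onto a small part of \<open>G\<close> full of short cycles. Adding the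
  values of \<open>f\<close> along a fibre could cancel them; the root of the sum of their squares
  cannot vanish unless all of them do, and it works for \<open>f\<close> of any sign. Two notions
  need care before they can be used. The universal cover is picked by a choice operator, so a tree
  with degree matrix \<open>D\<close> has to be exhibited: condition (D1) makes its vertex degrees
  come out right and (D2) makes every type occur. And \<rho> is a \<open>lim\<close>, which is
  informative only once the spectral radii of the balls are known to increase and to stay bounded.
  The radius splits as \<open>s + n\<close>: the ball carrying \<open>f\<close> has radius
  \<open>n\<close>, and \<open>s\<close> bounds the distance to a vertex of the right type. Both
  depend on \<open>D\<close> and \<epsilon> alone. The number \<open>2 * r + 1\<close> arises
  because two vertices at distance at least \<open>2 * r + 2\<close> have \<open>r\<close>-balls
  that neither meet nor are joined by an edge, so the quadratic form has no cross terms.\<close>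

lemma symmetric_real_mat_eigenvalue_exists:
  fixes A :: "real mat"
  assumes A: "A \<in> carrier_mat n n" and sym: "\<And>i j. i < n \<Longrightarrow> j < n \<Longrightarrow> A $$ (i, j) = A $$ (j, i)"
    and n: "n > 0"
  shows "\<exists>e. eigenvalue A e"
proof -
  let ?C = "map_mat complex_of_real A"
  have C: "?C \<in> carrier_mat n n" using A by auto
  obtain as where as: "char_poly ?C = (\<Prod>a\<leftarrow>as. [:- a, 1:])" "length as = n"
    using char_poly_factorized[OF C] by blast
  obtain z as' where "as = z # as'" using as(2) n by (cases as) auto
  then have root: "poly (char_poly ?C) z = 0" using as(1) by simp
  then have "eigenvalue ?C z" using eigenvalue_root_char_poly[OF C] by simp
  then obtain v where v: "v \<in> carrier_vec n" "v \<noteq> 0\<^sub>v n" "?C *\<^sub>v v = z \<cdot>\<^sub>v v"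
    using C unfolding eigenvalue_def eigenvector_def by auto
  have ent: "(\<Sum>j<n. of_real (A $$ (i, j)) * v $ j) = z * v $ i" if "i < n" for i
  proof -
    have "(?C *\<^sub>v v) $ i = (\<Sum>j<n. of_real (A $$ (i, j)) * v $ j)"
      using A v(1) that by (auto simp: mult_mat_vec_def scalar_prod_def atLeast0LessThan row_def intro!: sum.cong)
    then show ?thesis using v(1,3) that by simp
  qed
  define N where "N = (\<Sum>i<n. (cmod (v $ i))\<^sup>2)"
  \<comment> \<open>\<open>Q\<close> is the Hermitian form of \<open>A\<close> at \<open>v\<close>.
    The eigenvalue equation evaluates it to \<open>z * N\<close>, while exchanging the indices and
    using the symmetry of \<open>A\<close> shows that it is its own conjugate. Hence
    \<open>z\<close> is real.\<close>
  define Q where "Q = (\<Sum>i<n. \<Sum>j<n. of_real (A $$ (i, j)) * v $ j * cnj (v $ i))"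
  have "Q = (\<Sum>i<n. z * v $ i * cnj (v $ i))"
    unfolding Q_def by (intro sum.cong refl) (simp add: ent[symmetric] sum_distrib_right)
  also have "\<dots> = z * of_real N"
    unfolding N_def by (simp add: sum_distrib_left mult.assoc flip: complex_norm_square)
  finally have Q: "Q = z * of_real N" .
  have "cnj Q = (\<Sum>i<n. \<Sum>j<n. of_real (A $$ (j, i)) * v $ i * cnj (v $ j))"
    unfolding Q_def cnj_sum by (intro sum.cong refl) (simp add: sym mult.commute mult.left_commute)
  also have "\<dots> = Q" unfolding Q_def by (rule sum.swap)
  finally have "cnj z * of_real N = z * of_real N" using Q by simp
  moreover have "N \<noteq> 0"
  proof
    assume "N = 0"
    then have "\<forall>i<n. v $ i = 0" unfolding N_def by (simp add: sum_nonneg_eq_0_iff)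
    then have "v = 0\<^sub>v n" using v(1) by (intro eq_vecI) auto
    then show False using v(2) by simp
  qed
  ultimately have "cnj z = z" by simp
  then obtain e where e: "z = of_real e" by (metis Reals_cnj_iff Reals_cases)
  have "char_poly ?C = map_poly complex_of_real (char_poly A)"
    using of_real_hom.char_poly_hom[OF A] .
  then have "poly (char_poly A) e = 0" using root e by simp
  then show ?thesis using eigenvalue_root_char_poly[OF A] by blast
qed

text \<open>\<open>W\<close> is the Householder reflection exchanging \<open>v\<close> and the first unit vector.\<close>
lemma orthogonal_mat_with_first_column:
  fixes v :: "real vec"
  assumes v: "v \<in> carrier_vec n" and unit: "v \<bullet> v = 1" and n: "n > 0"
  shows "\<exists>W \<in> carrier_mat n n. W\<^sup>T = W \<and> W * W = 1\<^sub>m n \<and> col W 0 = v"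
proof -
  define w where "w i = v $ i - (if i = 0 then 1 else 0)" for i
  have vv: "(\<Sum>i<n. v $ i * v $ i) = 1"
    using unit v by (simp add: scalar_prod_def atLeast0LessThan)
  define s where "s = (\<Sum>i<n. w i * w i)"
  have "s = (\<Sum>i<n. v $ i * v $ i - 2 * (if i = 0 then v $ i else 0) + (if i = 0 then 1 else 0))"
    unfolding s_def w_def by (intro sum.cong refl) (auto simp: algebra_simps)
  also have "\<dots> = 2 - 2 * v $ 0"
    using n by (simp add: sum.distrib sum_subtractf vv flip: sum_distrib_left)
  finally have s: "s = 2 - 2 * v $ 0" .
  show ?thesis
  proof (cases "s = 0")
    \<comment> \<open>Here \<open>s\<close> is the squared distance from \<open>v\<close> to the
      first unit vector, so the two coincide and no reflection is defined; the identity
      serves.\<close>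
    case True
    then have "\<forall>i<n. w i = 0" unfolding s_def by (simp add: sum_nonneg_eq_0_iff)
    then have "col (1\<^sub>m n) 0 = v" using v n by (intro eq_vecI) (auto simp: w_def)
    then show ?thesis by (intro bexI[of _ "1\<^sub>m n"]) auto
  next
    case False
    define W where "W = mat n n (\<lambda>(i, j). (if i = j then 1 else 0) - 2 * w i * w j / s)"
    have W: "W \<in> carrier_mat n n" by (simp add: W_def)
    have "W * W = 1\<^sub>m n"
    proof (rule eq_matI)
      fix i j assume ij: "i < dim_row (1\<^sub>m n)" "j < dim_col (1\<^sub>m n)"
      have "(W * W) $$ (i, j) = (\<Sum>k<n. ((if i = k then 1 else 0) - 2 * w i * w k / s) *
          ((if k = j then 1 else 0) - 2 * w k * w j / s))"
        using ij by (simp add: W_def scalar_prod_def atLeast0LessThan)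
      also have "\<dots> = (\<Sum>k<n. (if k = i then (if k = j then 1 else 0) else 0) -
          (if k = j then 2 * w i * w k / s else 0) -
          (if k = i then 2 * w k * w j / s else 0) + (4 * w i * w j / s\<^sup>2) * (w k * w k))"
        by (intro sum.cong refl) (auto simp: algebra_simps power2_eq_square)
      also have "\<dots> = (if i = j then 1 else 0)  - 2 * w i * w j / s - 2 * w i * w j / s
          + (4 * w i * w j / s\<^sup>2) * s"
        using ij unfolding sum.distrib sum_subtractf sum_distrib_left[symmetric] s_def[symmetric]
        by simp
      also have "\<dots> = 1\<^sub>m n $$ (i, j)"
        using False ij by (simp add: field_simps power2_eq_square)
      finally show "(W * W) $$ (i, j) = 1\<^sub>m n $$ (i, j)" .
    qed (simp_all add: W_def)
    moreover have "W\<^sup>T = W" by (rule eq_matI) (auto simp: W_def)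
    moreover have "col W 0 = v"
    proof (rule eq_vecI)
      fix i assume i: "i < dim_vec v"
      have "2 * w 0 / s = -1" using False by (simp add: s w_def field_simps)
      then have "w i * (2 * w 0 / s) = - w i" by simp
      then show "col W 0 $ i = v $ i" using i v n by (simp add: W_def w_def algebra_simps)
    qed (use v in \<open>simp add: W_def\<close>)
    ultimately show ?thesis using W by blast
  qed
qed

text \<open>Deflation: conjugation with the reflection \<open>W\<close> turns a unit eigenvector
  into the first basis vector. The first column of \<open>B\<close> is then a multiple of that
  vector, symmetry gives the same for the first row, and the induction hypothesis applies to the
  remaining block.\<close>

theorem symmetric_real_mat_diagonalization:
  fixes A :: "real mat"
  assumes "A \<in> carrier_mat n n" and "A\<^sup>T = A"
  shows "\<exists>P e. P \<in> carrier_mat n n \<and> P\<^sup>T * P = 1\<^sub>m n \<and> A * P = P * mat_diag n e"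
  using assms
proof (induction n arbitrary: A)
  case 0
  then show ?case by (intro exI[of _ "1\<^sub>m 0"] conjI exI[of _ "\<lambda>_. 0"] eq_matI)
      (auto simp: mat_diag_def)
next
  case (Suc n)
  let ?n = "Suc n"
  note A = Suc.prems(1)
  have sym: "A $$ (i, j) = A $$ (j, i)" if "i < ?n" "j < ?n" for i j
    using Suc.prems that by (metis carrier_matD index_transpose_mat(1))
  obtain e where "eigenvalue A e"
    using symmetric_real_mat_eigenvalue_exists[OF A sym] by auto
  then obtain u where u: "u \<in> carrier_vec ?n" "u \<noteq> 0\<^sub>v ?n" "A *\<^sub>v u = e \<cdot>\<^sub>v u"
    using A unfolding eigenvalue_def eigenvector_def by auto
  have uu: "u \<bullet> u > 0"
    using u(1,2) conjugate_square_greater_0_vec[of u ?n] by simp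
  define v where "v = (1 / sqrt (u \<bullet> u)) \<cdot>\<^sub>v u"
  have v: "v \<in> carrier_vec ?n" using u(1) by (simp add: v_def)
  have "v \<bullet> v = 1" using u(1) uu by (simp add: v_def)
  moreover have Av: "A *\<^sub>v v = e \<cdot>\<^sub>v v"
    using A u by (simp add: v_def mult_mat_vec smult_smult_assoc mult.commute)
  ultimately obtain W where W: "W \<in> carrier_mat ?n ?n" "W\<^sup>T = W" "W * W = 1\<^sub>m ?n" "col W 0 = v"
    using orthogonal_mat_with_first_column[OF v] by blast
  define B where "B = W * A * W"
  have B: "B \<in> carrier_mat ?n ?n" using W A by (simp add: B_def)
  have BT: "B\<^sup>T = B"
    using W A Suc.prems(2) by (simp add: B_def transpose_mult[of _ ?n ?n _ ?n] assoc_mult_mat[of _ ?n ?n _ ?n _ ?n])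
  have "col B 0 = W *\<^sub>v (A *\<^sub>v col W 0)"
    unfolding B_def by (subst col_mult2[of _ ?n ?n _ ?n], use W A v in auto)
  also have "\<dots> = e \<cdot>\<^sub>v (W *\<^sub>v col W 0)"
    using W v by (simp add: Av mult_mat_vec[of _ ?n ?n])
  also have "W *\<^sub>v col W 0 = col (1\<^sub>m ?n) 0"
    by (metis W(1,3) col_mult2 zero_less_Suc)
  finally have colB: "col B 0 = e \<cdot>\<^sub>v col (1\<^sub>m ?n) 0" .
  have B0: "B $$ (i, 0) = (if i = 0 then e else 0)" if "i < ?n" for i
    using arg_cong[OF colB, of "\<lambda>x. x $ i"] B that by auto
  have B0': "B $$ (0, i) = (if i = 0 then e else 0)" if "i < ?n" for i
    using B0[OF that] BT B that by (metis carrier_matD index_transpose_mat(1) zero_less_Suc)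
  define A3 where "A3 = mat n n (\<lambda>(i, j). B $$ (Suc i, Suc j))"
  have A3: "A3 \<in> carrier_mat n n" by (simp add: A3_def)
  have "A3\<^sup>T = A3"
  proof (rule eq_matI)
    fix i j assume "i < dim_row A3" "j < dim_col A3"
    then have "i < n" "j < n" by (auto simp: A3_def)
    then show "A3\<^sup>T $$ (i, j) = A3 $$ (i, j)"
      using BT B by (simp add: A3_def) (metis Suc_less_eq carrier_matD index_transpose_mat(1))
  qed (auto simp: A3_def)
  then obtain P3 f where P3: "P3 \<in> carrier_mat n n" "P3\<^sup>T * P3 = 1\<^sub>m n" "A3 * P3 = P3 * mat_diag n f"
    using Suc.IH[OF A3] by blast
  \<comment> \<open>\<open>blk c M\<close> is the direct sum of the scalar \<open>c\<close> and
    \<open>M\<close>. Such sums multiply and transpose blockwise, which reduces every matrix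
    identity below to one about the smaller block.\<close>
  define blk where "blk c M = four_block_mat (mat 1 1 (\<lambda>_. c :: real)) (0\<^sub>m 1 n) (0\<^sub>m n 1) M" for c M
  have blk_carrier: "blk c M \<in> carrier_mat ?n ?n" if "M \<in> carrier_mat n n" for c M
    using four_block_carrier_mat[of "mat 1 1 (\<lambda>_. c)" 1 1 M n n] that by (simp add: blk_def)
  have blk_mult: "blk c M * blk d N = blk (c * d) (M * N)"
    if "M \<in> carrier_mat n n" "N \<in> carrier_mat n n" for c d M N
  proof -
    have "mat 1 1 (\<lambda>_. c) * mat 1 1 (\<lambda>_. d) = mat 1 1 (\<lambda>_. c * d)"
      by (rule eq_matI) (auto simp: scalar_prod_def)
    then show ?thesis
      using that unfolding blk_def
      by (subst mult_four_block_mat[where ?nr1.0 = 1 and ?n1.0 = 1 and ?n2.0 = n and ?nr2.0 = n and ?nc1.0 = 1 and ?nc2.0 = n]) auto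
  qed
  have blkT: "(blk c M)\<^sup>T = blk c (M\<^sup>T)" if "M \<in> carrier_mat n n" for c M
    using that unfolding blk_def
    by (subst transpose_four_block_mat[where ?nr1.0 = 1 and ?nc1.0 = 1 and ?nc2.0 = n and ?nr2.0 = n])
       (auto intro!: arg_cong2[where f = "\<lambda>X Y. four_block_mat X _ _ Y"])
  have B_blk: "B = blk e A3"
    by (rule eq_matI) (use B A3 B0 B0' in \<open>auto simp: blk_def A3_def\<close>)
  have one_blk: "1\<^sub>m ?n = blk 1 (1\<^sub>m n)"
    by (rule eq_matI) (auto simp: blk_def)
  have diag_blk: "mat_diag ?n (\<lambda>i. if i = 0 then e else f (i - 1)) = blk e (mat_diag n f)"
    by (rule eq_matI) (auto simp: blk_def mat_diag_def)
  let ?P = "W * blk 1 P3" and ?D = "mat_diag ?n (\<lambda>i. if i = 0 then e else f (i - 1))"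
  have bP: "blk 1 P3 \<in> carrier_mat ?n ?n" using blk_carrier P3 by blast
  have D: "?D \<in> carrier_mat ?n ?n" by simp
  have P: "?P \<in> carrier_mat ?n ?n" using W bP by auto
  have "?P\<^sup>T * ?P = (blk 1 P3)\<^sup>T * (W * W) * blk 1 P3"
    using W(1,2) bP by (simp add: transpose_mult[of _ ?n ?n _ ?n] assoc_mult_mat[of _ ?n ?n _ ?n _ ?n])
  also have "\<dots> = (blk 1 P3)\<^sup>T * blk 1 P3"
    using W(3) bP by (simp add: right_mult_one_mat[of _ ?n ?n])
  also have "\<dots> = 1\<^sub>m ?n" using P3 by (simp add: blkT blk_mult one_blk)
  finally have PP: "?P\<^sup>T * ?P = 1\<^sub>m ?n" .
  have "A * ?P = (W * W) * (A * ?P)" using W(3) A P by (simp add: left_mult_one_mat[of _ ?n ?n])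
  also have "\<dots> = W * (B * blk 1 P3)"
    using W(1) A bP by (simp add: B_def assoc_mult_mat[of _ ?n ?n _ ?n _ ?n])
  also have "B * blk 1 P3 = blk 1 P3 * ?D"
    using A3 P3 by (simp add: B_blk diag_blk blk_mult)
  also have "W * (blk 1 P3 * ?D) = ?P * ?D"
    using W(1) bP D by (simp add: assoc_mult_mat[of _ ?n ?n _ ?n _ ?n])
  finally show ?case using P PP by blast
qed

section \<open>Quadratic forms and eigenvalue counts\<close>

text \<open>Gaussian elimination of one equation at a time. This is the dimension count behind the
  min-max principle: it produces a combination of test functions orthogonal to given
  eigenfunctions.\<close>

lemma underdetermined_system_nontrivial_solution:
  fixes a :: "'j \<Rightarrow> 'i \<Rightarrow> 'a :: field"
  assumes "finite J" "finite I" "card J < card I"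
  shows "\<exists>x. (\<exists>i\<in>I. x i \<noteq> 0) \<and> (\<forall>j\<in>J. (\<Sum>i\<in>I. a j i * x i) = 0)"
  using assms
proof (induction J arbitrary: I a rule: finite_induct)
  case empty
  then obtain i where "i \<in> I" by (metis card.empty card_gt_0_iff ex_in_conv)
  then show ?case by (intro exI[of _ "\<lambda>_. 1"]) auto
next
  case (insert j J)
  show ?case
  proof (cases "\<forall>i\<in>I. a j i = 0")
    case True
    moreover have "card J < card I" using insert by simp
    ultimately show ?thesis using insert.IH[of I a] insert.prems(1) by auto
  next
    case False
    then obtain k where k: "k \<in> I" "a j k \<noteq> 0" by blast
    let ?I = "I - {k}"
    have I: "finite ?I" "card J < card ?I" using insert k by auto
    \<comment> \<open>The coefficients that remain after equation \<open>j\<close> has been solved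
      for the unknown \<open>k\<close>; the value \<open>- s / a j k\<close> given to
      \<open>k\<close> in \<open>y\<close> is that solution.\<close>
    define b where "b j' i = a j' i - a j' k * a j i / a j k" for j' i
    obtain x where x: "\<exists>i\<in>?I. x i \<noteq> 0" "\<forall>j'\<in>J. (\<Sum>i\<in>?I. b j' i * x i) = 0"
      using insert.IH[OF I] by blast
    define s where "s = (\<Sum>i\<in>?I. a j i * x i)"
    define y where "y = x(k := - s / a j k)"
    have split: "(\<Sum>i\<in>I. a j' i * y i) = (\<Sum>i\<in>?I. a j' i * x i) - a j' k * s / a j k" for j'
    proof -
      have "(\<Sum>i\<in>I. a j' i * y i) = a j' k * y k + (\<Sum>i\<in>?I. a j' i * y i)"
        using k(1) insert.prems(1) by (rule sum.remove[rotated])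
      also have "(\<Sum>i\<in>?I. a j' i * y i) = (\<Sum>i\<in>?I. a j' i * x i)"
        by (intro sum.cong) (auto simp: y_def)
      finally show ?thesis by (simp add: y_def)
    qed
    have "(\<Sum>i\<in>I. a j' i * y i) = 0" if "j' \<in> J" for j'
    proof -
      have "0 = (\<Sum>i\<in>?I. a j' i * x i - a j' k * (a j i * x i) / a j k)"
        using x(2) that by (simp add: b_def algebra_simps)
      then show ?thesis
        by (simp add: split s_def sum_subtractf sum_distrib_left sum_divide_distrib)
    qed
    moreover have "(\<Sum>i\<in>I. a j i * y i) = 0"
      using k(2) by (simp add: split s_def[symmetric])
    moreover have "\<exists>i\<in>I. y i \<noteq> 0" using x(1) by (auto simp: y_def)
    ultimately show ?thesis by (intro exI[of _ y]) auto
  qed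
qed

text \<open>The form of the adjacency matrix: every edge is counted in both directions.\<close>

definition graph_form :: "('v, 'e) pre_digraph \<Rightarrow> ('v \<Rightarrow> real) \<Rightarrow> real" where
  "graph_form G f = (\<Sum>u\<in>verts G. \<Sum>w\<in>neighbors G u. f u * f w)"

lemma (in wf_digraph) neighbors_subset_verts: "neighbors G u \<subseteq> verts G"
  by (auto simp: neighbors_def adj_in_verts)

lemma (in sym_digraph) neighbors_sym: "w \<in> neighbors G u \<longleftrightarrow> u \<in> neighbors G w"
  using sym_arcs by (auto simp: neighbors_def symmetric_def sym_def)

text \<open>Translates the diagonalization into eigenfunctions on the vertices, so that the
  arbitrary \<open>vertex_list\<close> is confined to this proof. Orthonormality and completeness
  are the two identities saying that \<open>P\<close> is orthogonal.\<close>

lemma (in graph) spectral_decomposition: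
  obtains e :: "nat \<Rightarrow> real" and p :: "nat \<Rightarrow> 'a \<Rightarrow> real" where
    "graph_eigenvalues G = image_mset e (mset_set {..<card (verts G)})"
    "{x. eigenvalue (adjacency_mat G) x} = e ` {..<card (verts G)}"
    "\<And>i u. i < card (verts G) \<Longrightarrow> u \<in> verts G \<Longrightarrow> (\<Sum>w\<in>neighbors G u. p i w) = e i * p i u"
    "\<And>i j. i < card (verts G) \<Longrightarrow> j < card (verts G) \<Longrightarrow>
       (\<Sum>u\<in>verts G. p i u * p j u) = (if i = j then 1 else 0)"
    "\<And>u w. u \<in> verts G \<Longrightarrow> w \<in> verts G \<Longrightarrow>
       (\<Sum>i<card (verts G). p i u * p i w) = (if u = w then 1 else 0)"
proof -
  define n where "n = card (verts G)"
  define vs where "vs = vertex_list G"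
  have vs: "distinct vs" "set vs = verts G"
    using someI_ex[OF finite_distinct_list[OF finite_verts]]
    unfolding vs_def vertex_list_def by (auto simp: conj_commute)
  have len: "length vs = n" using vs by (simp add: n_def distinct_card flip: vs(2))
  have bij: "bij_betw ((!) vs) {..<n} (verts G)"
    using bij_betw_nth[OF vs(1)] vs(2) len by blast
  define ix where "ix = the_inv_into {..<n} ((!) vs)"
  have ix: "ix (vs ! i) = i" if "i < n" for i
    using that bij unfolding ix_def by (simp add: bij_betw_def the_inv_into_f_f)
  have ix_less: "ix u < n" and ix_vs: "vs ! ix u = u" if "u \<in> verts G" for u
    using that ix len unfolding vs(2)[symmetric] in_set_conv_nth by auto
  have sum_verts: "(\<Sum>u\<in>verts G. F u) = (\<Sum>i<n. F (vs ! i))" for F :: "'a \<Rightarrow> real"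
    using sum.reindex_bij_betw[OF bij, of F] by simp
  define A where "A = adjacency_mat G"
  have A: "A \<in> carrier_mat n n" by (simp add: A_def adjacency_mat_def n_def)
  have A_ix: "A $$ (i, j) = (if vs ! j \<in> neighbors G (vs ! i) then 1 else 0)" if "i < n" "j < n" for i j
    using that by (simp add: A_def adjacency_mat_def n_def vs_def neighbors_def)
  have "A\<^sup>T = A"
    by (rule eq_matI) (use A in \<open>auto simp: A_ix neighbors_sym\<close>)
  then obtain P e where P: "P \<in> carrier_mat n n" "P\<^sup>T * P = 1\<^sub>m n" and AP: "A * P = P * mat_diag n e"
    using symmetric_real_mat_diagonalization[OF A] by blast
  let ?D = "mat_diag n e"
  have D: "?D \<in> carrier_mat n n" by simp
  have PP: "P * P\<^sup>T = 1\<^sub>m n" using mat_mult_left_right_inverse[OF _ P(1) P(2)] P(1) by simp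
  have "A = A * (P * P\<^sup>T)" using A by (simp add: PP)
  also have "\<dots> = A * P * P\<^sup>T"
    using assoc_mult_mat[of A n n P n "P\<^sup>T" n] A P(1) by simp
  also note AP
  finally have "A = P * ?D * P\<^sup>T" .
  moreover have "{A, ?D, P, P\<^sup>T} \<subseteq> carrier_mat n n" using A P(1) by simp
  ultimately have sim: "similar_mat A ?D"
    using PP P(2) by (intro similar_matI[of _ _ P "P\<^sup>T" n])
  have "char_poly A = char_poly ?D" by (rule char_poly_similar[OF sim])
  also have "\<dots> = (\<Prod>a\<leftarrow>diag_mat ?D. [:- a, 1:])"
    by (rule char_poly_upper_triangular[OF D]) (auto simp: mat_diag_def)
  also have "diag_mat ?D = map e [0..<n]"
    by (auto simp: diag_mat_def mat_diag_def)
  finally have cp: "char_poly A = (\<Prod>a\<leftarrow>map e [0..<n]. [:- a, 1:])" .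
  have nz: "(\<Prod>a\<leftarrow>xs. [:- a, 1:]) \<noteq> 0" for xs :: "real list"
    by (auto simp: prod_list_zero_iff)
  have "proots (\<Prod>a\<leftarrow>xs. [:- a, 1:]) = mset xs" for xs :: "real list"
  proof (induction xs)
    case (Cons a xs)
    have "proots (\<Prod>b\<leftarrow>a # xs. [:- b, 1:]) = proots [:- a, 1:] + proots (\<Prod>b\<leftarrow>xs. [:- b, 1:])"
      unfolding list.map prod_list.Cons by (rule proots_mult) (use nz in auto)
    then show ?case using Cons by simp
  qed simp
  then have "proots (char_poly A) = mset (map e [0..<n])" unfolding cp .
  also have "\<dots> = image_mset e (mset_set {..<n})"
    by (simp add: atLeast0LessThan flip: mset_set_upto_eq_mset_upto)
  finally have ev: "graph_eigenvalues G = image_mset e (mset_set {..<n})"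
    by (simp add: graph_eigenvalues_def A_def)
  have ev': "{x. eigenvalue A x} = e ` {..<n}"
    unfolding eigenvalue_root_char_poly[OF A] cp by (auto simp: poly_prod_list prod_list_zero_iff)
  define p where "p i u = P $$ (ix u, i)" for i u
  have "(\<Sum>w\<in>neighbors G u. p i w) = e i * p i u" if i: "i < n" and u: "u \<in> verts G" for i u
  proof -
    have "(\<Sum>w\<in>neighbors G u. p i w) = (\<Sum>w\<in>verts G. if w \<in> neighbors G u then p i w else 0)"
      using neighbors_subset_verts[of u] by (simp add: sum.inter_restrict[symmetric] Int_absorb1)
    also have "\<dots> = (\<Sum>k<n. A $$ (ix u, k) * P $$ (k, i))"
      unfolding sum_verts using u by (intro sum.cong) (auto simp: A_ix ix_less ix_vs p_def ix)
    also have "\<dots> = (A * P) $$ (ix u, i)"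
      using A P(1) i u by (simp add: scalar_prod_def ix_less atLeast0LessThan)
    also have "\<dots> = (P * ?D) $$ (ix u, i)" by (simp add: AP)
    also have "\<dots> = e i * p i u"
      using P(1) i u by (subst mat_diag_mult_right[of _ n]) (auto simp: p_def ix_less)
    finally show ?thesis .
  qed
  moreover have "(\<Sum>u\<in>verts G. p i u * p j u) = (if i = j then 1 else 0)" if "i < n" "j < n" for i j
  proof -
    have "(\<Sum>u\<in>verts G. p i u * p j u) = (P\<^sup>T * P) $$ (i, j)"
      using P(1) that by (simp add: sum_verts scalar_prod_def ix p_def atLeast0LessThan)
    then show ?thesis using that P(2) by simp
  qed
  moreover have "(\<Sum>i<n. p i u * p i w) = (if u = w then 1 else 0)" if "u \<in> verts G" "w \<in> verts G" for u w
  proof -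
    have "(\<Sum>i<n. p i u * p i w) = (P * P\<^sup>T) $$ (ix u, ix w)"
      using P(1) that by (simp add: scalar_prod_def p_def atLeast0LessThan ix_less)
    also have "\<dots> = (if ix u = ix w then 1 else 0)" using that by (simp add: PP ix_less)
    finally show ?thesis using that by (metis ix_vs)
  qed
  ultimately show ?thesis
    using that[of e p] ev ev' unfolding n_def A_def by blast
qed

text \<open>\<open>c h i\<close> is the coordinate of \<open>h\<close> along the \<open>i\<close>-th
  eigenfunction. Completeness expands \<open>h\<close> in these coordinates, in which the form is
  diagonal.\<close>

lemma (in graph) parseval:
  assumes p: "\<And>i u. i < n \<Longrightarrow> u \<in> verts G \<Longrightarrow> (\<Sum>w\<in>neighbors G u. p i w) = e i * p i u"
    and compl: "\<And>u w. u \<in> verts G \<Longrightarrow> w \<in> verts G \<Longrightarrow>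
       (\<Sum>i<n. p i u * p i w) = (if u = w then 1 else 0)"
  defines "c \<equiv> \<lambda>h i. \<Sum>u\<in>verts G. p i u * h u"
  shows "(\<Sum>u\<in>verts G. (h u)\<^sup>2) = (\<Sum>i<n. (c h i)\<^sup>2)"
    and "graph_form G h = (\<Sum>i<n. e i * (c h i)\<^sup>2)"
proof -
  have h: "h u = (\<Sum>i<n. c h i * p i u)" if "u \<in> verts G" for u
  proof -
    have "(\<Sum>i<n. c h i * p i u) = (\<Sum>i<n. \<Sum>w\<in>verts G. p i u * p i w * h w)"
      unfolding c_def sum_distrib_right by (intro sum.cong refl) (simp add: mult_ac)
    also have "\<dots> = (\<Sum>w\<in>verts G. (\<Sum>i<n. p i u * p i w) * h w)"
      by (subst sum.swap) (simp add: sum_distrib_right)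
    also have "\<dots> = (\<Sum>w\<in>verts G. if w = u then h w else 0)"
      using that by (intro sum.cong) (auto simp: compl)
    finally show ?thesis using that by simp
  qed
  have "(\<Sum>u\<in>verts G. (h u)\<^sup>2) = (\<Sum>u\<in>verts G. \<Sum>i<n. c h i * p i u * h u)"
    by (intro sum.cong refl) (metis h power2_eq_square sum_distrib_right)
  also have "\<dots> = (\<Sum>i<n. c h i * (\<Sum>u\<in>verts G. p i u * h u))"
    by (subst sum.swap) (simp add: sum_distrib_left mult_ac)
  finally show "(\<Sum>u\<in>verts G. (h u)\<^sup>2) = (\<Sum>i<n. (c h i)\<^sup>2)"
    by (simp add: c_def power2_eq_square)
  have "(\<Sum>w\<in>neighbors G u. h u * h w) = (\<Sum>i<n. e i * c h i * (p i u * h u))"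
    if u: "u \<in> verts G" for u
  proof -
    have "(\<Sum>w\<in>neighbors G u. h w) = (\<Sum>w\<in>neighbors G u. \<Sum>i<n. c h i * p i w)"
      using neighbors_subset_verts[of u] by (intro sum.cong refl h) auto
    also have "\<dots> = (\<Sum>i<n. c h i * (\<Sum>w\<in>neighbors G u. p i w))"
      by (subst sum.swap) (simp add: sum_distrib_left)
    also have "\<dots> = (\<Sum>i<n. c h i * (e i * p i u))" using u by (simp add: p)
    finally have "h u * (\<Sum>w\<in>neighbors G u. h w) = h u * (\<Sum>i<n. c h i * (e i * p i u))" by simp
    then show ?thesis by (simp add: sum_distrib_left mult_ac)
  qed
  then have "graph_form G h = (\<Sum>u\<in>verts G. \<Sum>i<n. e i * c h i * (p i u * h u))"
    unfolding graph_form_def by (rule sum.cong[OF refl])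
  also have "\<dots> = (\<Sum>i<n. e i * c h i * (\<Sum>u\<in>verts G. p i u * h u))"
    by (subst sum.swap) (simp add: sum_distrib_left)
  finally show "graph_form G h = (\<Sum>i<n. e i * (c h i)\<^sup>2)"
    by (simp add: c_def power2_eq_square mult_ac)
qed

text \<open>One half of the min-max principle. The assumption \<open>nz\<close> is linear
  independence of the functions \<open>g i\<close> on the vertices. With fewer than
  \<open>card I\<close> eigenvalues at or above \<open>b\<close>, some nontrivial combination would
  be orthogonal to all their eigenfunctions, and its form would involve only eigenvalues below
  \<open>b\<close>.\<close>

lemma (in graph) card_le_eigenvalue_count:
  fixes g :: "'i \<Rightarrow> 'a \<Rightarrow> real"
  assumes I: "finite I"
    and nz: "\<And>x. \<exists>i\<in>I. x i \<noteq> 0 \<Longrightarrow> \<exists>u\<in>verts G. (\<Sum>i\<in>I. x i * g i u) \<noteq> 0"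
    and form: "\<And>x. graph_form G (\<lambda>u. \<Sum>i\<in>I. x i * g i u) \<ge> b * (\<Sum>u\<in>verts G. (\<Sum>i\<in>I. x i * g i u)\<^sup>2)"
  shows "card I \<le> size {#x \<in># graph_eigenvalues G. x \<ge> b#}"
proof -
  let ?n = "card (verts G)"
  obtain e p where ev: "graph_eigenvalues G = image_mset e (mset_set {..<?n})"
    and ev': "{x. eigenvalue (adjacency_mat G) x} = e ` {..<?n}"
    and ep: "\<And>i u. i < ?n \<Longrightarrow> u \<in> verts G \<Longrightarrow> (\<Sum>w\<in>neighbors G u. p i w) = e i * p i u"
    and on: "\<And>i j. i < ?n \<Longrightarrow> j < ?n \<Longrightarrow> (\<Sum>u\<in>verts G. p i u * p j u) = (if i = j then 1 else 0)"
    and compl: "\<And>u w. u \<in> verts G \<Longrightarrow> w \<in> verts G \<Longrightarrow>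
       (\<Sum>i<?n. p i u * p i w) = (if u = w then 1 else 0)"
    by (rule spectral_decomposition) (rule that)
  define J where "J = {j. j < ?n \<and> e j \<ge> b}"
  have "size {#x \<in># graph_eigenvalues G. x \<ge> b#} = card J"
    unfolding ev J_def by (simp add: filter_mset_image_mset)
  moreover have "\<not> card J < card I"
  proof
    assume less: "card J < card I"
    have "finite J" by (simp add: J_def)
    then obtain x where x: "\<exists>i\<in>I. x i \<noteq> 0"
        "\<forall>j\<in>J. (\<Sum>i\<in>I. (\<Sum>u\<in>verts G. p j u * g i u) * x i) = 0"
      using underdetermined_system_nontrivial_solution[OF _ I less,
          of "\<lambda>j i. \<Sum>u\<in>verts G. p j u * g i u"] by blast
    define h where "h u = (\<Sum>i\<in>I. x i * g i u)" for u
    define c where "c j = (\<Sum>u\<in>verts G. p j u * h u)" for j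
    have cJ: "c j = 0" if "j \<in> J" for j
    proof -
      have "c j = (\<Sum>i\<in>I. (\<Sum>u\<in>verts G. p j u * g i u) * x i)"
        unfolding c_def h_def sum_distrib_left sum_distrib_right
        by (subst sum.swap) (simp add: mult_ac)
      then show ?thesis using x(2) that by simp
    qed
    have norm: "(\<Sum>u\<in>verts G. (h u)\<^sup>2) = (\<Sum>i<?n. (c i)\<^sup>2)"
      and fo: "graph_form G h = (\<Sum>i<?n. e i * (c i)\<^sup>2)"
      unfolding c_def using parseval[OF ep compl] by blast+
    \<comment> \<open>In the difference of the two sides, the terms with \<open>i\<close> in
      \<open>J\<close> vanish because \<open>c i = 0\<close>, and the others have a positive factor
      \<open>b - e i\<close>. Equality therefore forces every coordinate of \<open>h\<close> to
      vanish.\<close>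
    have "b * (\<Sum>i<?n. (c i)\<^sup>2) \<le> (\<Sum>i<?n. e i * (c i)\<^sup>2)"
      using form[of x] norm fo unfolding h_def by simp
    then have "(\<Sum>i<?n. (b - e i) * (c i)\<^sup>2) \<le> 0"
      by (simp add: left_diff_distrib sum_subtractf sum_distrib_left)
    moreover have nonneg: "(b - e i) * (c i)\<^sup>2 \<ge> 0" if "i < ?n" for i
      using that cJ[of i] by (cases "i \<in> J") (auto simp: J_def)
    ultimately have "(\<Sum>i<?n. (b - e i) * (c i)\<^sup>2) = 0"
      by (intro antisym sum_nonneg) auto
    then have "\<forall>i<?n. (b - e i) * (c i)\<^sup>2 = 0"
      using nonneg by (subst (asm) sum_nonneg_eq_0_iff) auto
    then have "c i = 0" if "i < ?n" for i
      using that cJ[of i] by (cases "i \<in> J") (auto simp: J_def)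
    then have "\<forall>u\<in>verts G. h u = 0" using norm by (simp add: sum_nonneg_eq_0_iff)
    then show False using nz[OF x(1)] by (simp add: h_def)
  qed
  ultimately show ?thesis by simp
qed

section \<open>From eigenvalue counts to single eigenvalues\<close>

text \<open>In the increasing list the \<open>k\<close>-th largest entry is at position
  \<open>length xs - k\<close>. If it were below \<open>b\<close>, so would be everything before it,
  leaving only \<open>k - 1\<close> positions for entries at or above \<open>b\<close>.\<close>

lemma kth_eigenvalue_ge:
  assumes "k \<ge> 1" "k \<le> size {#x \<in># graph_eigenvalues G. x \<ge> b#}"
  shows "kth_eigenvalue k G \<ge> b"
proof (rule ccontr)
  assume less: "\<not> ?thesis"
  define xs where "xs = sorted_list_of_multiset (graph_eigenvalues G)"
  have xs: "mset xs = graph_eigenvalues G" "sorted xs" by (auto simp: xs_def)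
  have k: "k \<le> card {i. i < length xs \<and> xs ! i \<ge> b}"
    using assms(2) unfolding xs(1)[symmetric]
    by (simp add: length_filter_conv_card flip: mset_filter)
  also have "\<dots> \<le> card {..<length xs}" by (intro card_mono) auto
  finally have kn: "k \<le> length xs" by simp
  have "kth_eigenvalue k G = xs ! (length xs - k)"
    using assms(1) kn by (simp add: kth_eigenvalue_def xs_def[symmetric] rev_nth)
  then have "xs ! i < b" if "i \<le> length xs - k" for i
    using sorted_nth_mono[OF xs(2) that] less assms(1) kn by force
  then have "{i. i < length xs \<and> xs ! i \<ge> b} \<subseteq> {length xs - k<..<length xs}"
    by (auto simp: not_le[symmetric])
  then have "card {i. i < length xs \<and> xs ! i \<ge> b} \<le> card {length xs - k<..<length xs}"
    by (intro card_mono) auto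
  then show False using k assms(1) kn by simp
qed

lemma (in graph) largest_eigenvalue_attained:
  assumes "verts G \<noteq> {}"
  obtains f where "\<exists>u\<in>verts G. f u \<noteq> 0"
    "graph_form G f = largest_eigenvalue G * (\<Sum>u\<in>verts G. (f u)\<^sup>2)"
proof -
  let ?n = "card (verts G)"
  obtain e p where ev: "graph_eigenvalues G = image_mset e (mset_set {..<?n})"
    and ev': "{x. eigenvalue (adjacency_mat G) x} = e ` {..<?n}"
    and ep: "\<And>i u. i < ?n \<Longrightarrow> u \<in> verts G \<Longrightarrow> (\<Sum>w\<in>neighbors G u. p i w) = e i * p i u"
    and on: "\<And>i j. i < ?n \<Longrightarrow> j < ?n \<Longrightarrow> (\<Sum>u\<in>verts G. p i u * p j u) = (if i = j then 1 else 0)"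
    and compl: "\<And>u w. u \<in> verts G \<Longrightarrow> w \<in> verts G \<Longrightarrow>
       (\<Sum>i<?n. p i u * p i w) = (if u = w then 1 else 0)"
    by (rule spectral_decomposition) (rule that)
  have "?n > 0" using assms by (simp add: card_gt_0_iff)
  then have "Max (e ` {..<?n}) \<in> e ` {..<?n}" by (intro Max_in) auto
  then obtain i where i: "i < ?n" "largest_eigenvalue G = e i"
    unfolding largest_eigenvalue_def ev' by auto
  have "graph_form G (p i) = (\<Sum>u\<in>verts G. p i u * (\<Sum>w\<in>neighbors G u. p i w))"
    by (simp add: graph_form_def sum_distrib_left)
  also have "\<dots> = e i * (\<Sum>u\<in>verts G. (p i u)\<^sup>2)"
    using i(1) by (simp add: ep sum_distrib_left power2_eq_square mult_ac)
  finally have "graph_form G (p i) = largest_eigenvalue G * (\<Sum>u\<in>verts G. (p i u)\<^sup>2)" by (simp add: i)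
  moreover have "\<exists>u\<in>verts G. p i u \<noteq> 0"
    using on[OF i(1) i(1)] by (metis (no_types, lifting) mult_zero_left sum.neutral zero_neq_one)
  ultimately show ?thesis by (rule that[rotated])
qed

lemma (in graph) largest_eigenvalue_ge:
  assumes "\<exists>u\<in>verts G. f u \<noteq> 0" "graph_form G f \<ge> b * (\<Sum>u\<in>verts G. (f u)\<^sup>2)"
  shows "largest_eigenvalue G \<ge> b"
proof -
  let ?n = "card (verts G)"
  obtain e p where ev: "graph_eigenvalues G = image_mset e (mset_set {..<?n})"
    and ev': "{x. eigenvalue (adjacency_mat G) x} = e ` {..<?n}"
    and ep: "\<And>i u. i < ?n \<Longrightarrow> u \<in> verts G \<Longrightarrow> (\<Sum>w\<in>neighbors G u. p i w) = e i * p i u"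
    and on: "\<And>i j. i < ?n \<Longrightarrow> j < ?n \<Longrightarrow> (\<Sum>u\<in>verts G. p i u * p j u) = (if i = j then 1 else 0)"
    and compl: "\<And>u w. u \<in> verts G \<Longrightarrow> w \<in> verts G \<Longrightarrow>
       (\<Sum>i<?n. p i u * p i w) = (if u = w then 1 else 0)"
    by (rule spectral_decomposition) (rule that)
  have scale: "graph_form G (\<lambda>u. x * f u) = x\<^sup>2 * graph_form G f" for x :: real
    by (simp add: graph_form_def sum_distrib_left power2_eq_square mult_ac)
  \<comment> \<open>A single test function spans a line, so the counting lemma is applied to a
    one-element index set and yields one eigenvalue at or above \<open>b\<close>.\<close>
  have "card {()} \<le> size {#x \<in># graph_eigenvalues G. x \<ge> b#}"
  proof (rule card_le_eigenvalue_count[where g = "\<lambda>_. f"])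
    fix x :: "unit \<Rightarrow> real"
    show "graph_form G (\<lambda>u. \<Sum>i\<in>{()}. x i * f u) \<ge> b * (\<Sum>u\<in>verts G. (\<Sum>i\<in>{()}. x i * f u)\<^sup>2)"
      using mult_left_mono[OF assms(2), of "(x ())\<^sup>2"] scale[of "x ()"]
      by (simp add: power_mult_distrib sum_distrib_left[symmetric] mult.left_commute)
  qed (use assms(1) in auto)
  then have "{#x \<in># graph_eigenvalues G. x \<ge> b#} \<noteq> {#}"
    by (metis card_1_singleton_iff not_one_le_zero size_empty One_nat_def)
  then obtain x where "x \<in># graph_eigenvalues G" "x \<ge> b"
    by (metis (no_types, lifting) mem_Collect_eq multiset_nonemptyE set_mset_filter)
  then obtain i where "i < ?n" "e i \<ge> b" unfolding ev by auto
  then show ?thesis unfolding largest_eigenvalue_def ev' by (intro Max_ge_iff[THEN iffD2]) auto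
qed

text \<open>The inequality \<open>2 * f u * f w \<le> (f u)\<^sup>2 + (f w)\<^sup>2\<close>, summed
  over all ordered adjacent pairs, charges each square at most \<open>d\<close> times on either
  side. It provides the bound under which the limit defining \<rho> exists.\<close>

lemma (in graph) largest_eigenvalue_le_degree:
  assumes "verts G \<noteq> {}" and deg: "\<And>u. u \<in> verts G \<Longrightarrow> card (neighbors G u) \<le> d"
  shows "largest_eigenvalue G \<le> d"
proof -
  obtain f where f: "\<exists>u\<in>verts G. f u \<noteq> 0"
    "graph_form G f = largest_eigenvalue G * (\<Sum>u\<in>verts G. (f u)\<^sup>2)"
    using largest_eigenvalue_attained[OF assms(1)] .
  have sum_nb: "(\<Sum>w\<in>neighbors G u. F w) = (\<Sum>w\<in>verts G. if w \<in> neighbors G u then F w else 0)"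
    for u and F :: "'a \<Rightarrow> real"
    using neighbors_subset_verts[of u] by (simp add: sum.inter_restrict[symmetric] Int_absorb1)
  have swap: "(\<Sum>u\<in>verts G. \<Sum>w\<in>neighbors G u. (f w)\<^sup>2) = (\<Sum>u\<in>verts G. \<Sum>w\<in>neighbors G u. (f u)\<^sup>2)"
    unfolding sum_nb by (subst sum.swap) (simp add: neighbors_sym)
  have "2 * graph_form G f \<le> (\<Sum>u\<in>verts G. \<Sum>w\<in>neighbors G u. (f u)\<^sup>2 + (f w)\<^sup>2)"
    unfolding graph_form_def sum_distrib_left
    by (intro sum_mono) (metis sum_squares_bound mult.assoc)
  also have "\<dots> = 2 * (\<Sum>u\<in>verts G. \<Sum>w\<in>neighbors G u. (f u)\<^sup>2)"
    by (simp add: sum.distrib swap del: sum_constant)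
  also have "(\<Sum>u\<in>verts G. \<Sum>w\<in>neighbors G u. (f u)\<^sup>2) \<le> (\<Sum>u\<in>verts G. d * (f u)\<^sup>2)"
    by (intro sum_mono) (simp add: deg mult_right_mono)
  finally have "largest_eigenvalue G * (\<Sum>u\<in>verts G. (f u)\<^sup>2) \<le> d * (\<Sum>u\<in>verts G. (f u)\<^sup>2)"
    unfolding f(2) sum_distrib_left[symmetric] by simp
  moreover have "(\<Sum>u\<in>verts G. (f u)\<^sup>2) > 0"
    using f(1) by (metis finite_verts sum_pos2 zero_le_power2 zero_less_power2)
  ultimately show ?thesis by simp
qed

section \<open>Balls and trees\<close>

text \<open>The closed ball in a form suited to induction on the radius;
  \<open>distance_le_iff\<close> identifies it with the metric ball about a vertex. Since the zeroth
  power of a relation is the identity, \<open>v\<close> lies in it even if it is no vertex.\<close>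

definition hop_ball :: "('v, 'e) pre_digraph \<Rightarrow> nat \<Rightarrow> 'v \<Rightarrow> 'v set" where
  "hop_ball G n v = {u. \<exists>m\<le>n. (v, u) \<in> arcs_ends G ^^ m}"

lemma hop_ball_0 [simp]: "hop_ball G 0 v = {v}"
  by (auto simp: hop_ball_def)

lemma hop_ball_Suc: "hop_ball G (Suc n) v = hop_ball G n v \<union> (\<Union>u\<in>hop_ball G n v. neighbors G u)"
proof -
  have "w \<in> hop_ball G n v \<union> (\<Union>u\<in>hop_ball G n v. neighbors G u)"
    if w: "w \<in> hop_ball G (Suc n) v" for w
  proof -
    obtain m where "m \<le> Suc n" "(v, w) \<in> arcs_ends G ^^ m" using w by (auto simp: hop_ball_def)
    then show ?thesis by (cases m) (auto simp: hop_ball_def neighbors_def)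
  qed
  moreover have "hop_ball G n v \<subseteq> hop_ball G (Suc n) v"
    by (auto simp: hop_ball_def intro: le_SucI)
  moreover have "w \<in> hop_ball G (Suc n) v" if u: "u \<in> hop_ball G n v" "w \<in> neighbors G u" for u w
  proof -
    obtain m where "m \<le> n" "(v, u) \<in> arcs_ends G ^^ m" using u(1) by (auto simp: hop_ball_def)
    then have "Suc m \<le> Suc n" "(v, w) \<in> arcs_ends G ^^ Suc m"
      using u(2) by (auto simp: neighbors_def)
    then show ?thesis unfolding hop_ball_def by blast
  qed
  ultimately show ?thesis by blast
qed

lemma hop_ball_mono: "n \<le> m \<Longrightarrow> hop_ball G n v \<subseteq> hop_ball G m v"
  unfolding hop_ball_def using le_trans by blast

lemma self_in_hop_ball [simp]: "v \<in> hop_ball G n v"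
  using hop_ball_mono[of 0 n G v] by simp

lemma hop_ball_trans:
  assumes "u \<in> hop_ball G n v" "w \<in> hop_ball G m u"
  shows "w \<in> hop_ball G (n + m) v"
proof -
  obtain i j where "i \<le> n" "(v, u) \<in> arcs_ends G ^^ i" "j \<le> m" "(u, w) \<in> arcs_ends G ^^ j"
    using assms by (auto simp: hop_ball_def)
  then have "i + j \<le> n + m" "(v, w) \<in> arcs_ends G ^^ (i + j)" by (auto simp: relpow_add)
  then show ?thesis unfolding hop_ball_def by blast
qed

lemma (in sym_digraph) hop_ball_sym:
  assumes "u \<in> hop_ball G n v"
  shows "v \<in> hop_ball G n u"
proof -
  have "(y, x) \<in> arcs_ends G ^^ m" if "(x, y) \<in> arcs_ends G ^^ m" for m x y
    using that
  proof (induction m arbitrary: y)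
    case (Suc m)
    then obtain z where "(x, z) \<in> arcs_ends G ^^ m" "(z, y) \<in> arcs_ends G" by auto
    then show ?case using Suc.IH sym_arcs by (metis arcs_ends_symmetric relpow_Suc_I2)
  qed simp
  then show ?thesis using assms unfolding hop_ball_def by blast
qed

text \<open>Edges need to be preserved inside the ball only, because copies of a ball of the tree
  are given by maps that are controlled nowhere else.\<close>

lemma hop_ball_image:
  assumes hom: "\<And>x y. x \<rightarrow>\<^bsub>T\<^esub> y \<Longrightarrow> x \<in> hop_ball T n v \<Longrightarrow> y \<in> hop_ball T n v \<Longrightarrow> f x \<rightarrow>\<^bsub>G\<^esub> f y"
    and "u \<in> hop_ball T n v"
  shows "f u \<in> hop_ball G n (f v)"
proof -
  have "\<forall>u\<in>hop_ball T m v. f u \<in> hop_ball G m (f v)" if "m \<le> n" for m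
    using that
  proof (induction m)
    case (Suc m)
    have sub: "hop_ball T m v \<subseteq> hop_ball T n v" "hop_ball T (Suc m) v \<subseteq> hop_ball T n v"
      using Suc.prems by (auto intro!: hop_ball_mono)
    show ?case
    proof
      fix u assume u: "u \<in> hop_ball T (Suc m) v"
      show "f u \<in> hop_ball G (Suc m) (f v)"
      proof (cases "u \<in> hop_ball T m v")
        case True
        then show ?thesis using Suc by (auto simp: hop_ball_Suc)
      next
        case False
        then obtain x where "x \<in> hop_ball T m v" "x \<rightarrow>\<^bsub>T\<^esub> u"
          using u by (auto simp: hop_ball_Suc neighbors_def)
        moreover then have "f x \<rightarrow>\<^bsub>G\<^esub> f u" using hom u sub by blast
        ultimately show ?thesis using Suc by (auto simp: hop_ball_Suc neighbors_def)
      qed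
    qed
  qed simp
  then show ?thesis using assms(2) by blast
qed

lemma finite_hop_ball:
  assumes "\<And>u. finite (neighbors G u)"
  shows "finite (hop_ball G n v)"
  by (induction n) (auto simp: hop_ball_Suc assms)

text \<open>One more unit of radius adds at most \<open>d\<close> vertices for each one already
  present. The constant of the second claim comes from this bound.\<close>

lemma card_hop_ball_le:
  assumes "\<And>u. finite (neighbors G u)" "\<And>u. card (neighbors G u) \<le> d"
  shows "card (hop_ball G n v) \<le> Suc d ^ n"
proof (induction n)
  case (Suc n)
  have "card (hop_ball G (Suc n) v) \<le> card (hop_ball G n v) + card (\<Union>u\<in>hop_ball G n v. neighbors G u)"
    unfolding hop_ball_Suc by (rule card_Un_le)
  also have "card (\<Union>u\<in>hop_ball G n v. neighbors G u) \<le> (\<Sum>u\<in>hop_ball G n v. card (neighbors G u))"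
    by (intro card_UN_le finite_hop_ball assms)
  also have "\<dots> \<le> card (hop_ball G n v) * d"
    using sum_bounded_above[of "hop_ball G n v" "\<lambda>u. card (neighbors G u)" d] assms(2) by simp
  finally show ?case using Suc mult_le_mono1[OF Suc, of "Suc d"] by (simp add: algebra_simps)
qed simp

section \<open>Balls, walks and distances\<close>

context wf_digraph
begin

lemma hop_ball_subset_verts: "v \<in> verts G \<Longrightarrow> hop_ball G n v \<subseteq> verts G"
  by (induction n) (auto simp: hop_ball_Suc neighbors_def adj_in_verts)

lemma awalk_length_relpow:
  "(\<exists>p. awalk u p v \<and> length p = n) \<longleftrightarrow> u \<in> verts G \<and> (u, v) \<in> arcs_ends G ^^ n"
proof (induction n arbitrary: u)
  case 0
  then show ?case by (auto simp: awalk_Nil_iff)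
next
  case (Suc n)
  have "(\<exists>p. awalk u p v \<and> length p = Suc n) \<longleftrightarrow>
      (\<exists>e\<in>arcs G. tail G e = u \<and> (\<exists>p. awalk (head G e) p v \<and> length p = n))"
    by (metis awalk_Cons_iff length_Suc_conv)
  also have "\<dots> \<longleftrightarrow> u \<in> verts G \<and> (\<exists>w. (u, w) \<in> arcs_ends G \<and> (w, v) \<in> arcs_ends G ^^ n)"
    unfolding Suc.IH by (auto simp: arcs_ends_conv)
  also have "(\<exists>w. (u, w) \<in> arcs_ends G \<and> (w, v) \<in> arcs_ends G ^^ n) \<longleftrightarrow> (u, v) \<in> arcs_ends G ^^ Suc n"
    by (metis relpow_Suc_D2 relpow_Suc_I2)
  finally show ?case .
qed

lemma hop_ball_iff_awalk:
  assumes "v \<in> verts G"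
  shows "u \<in> hop_ball G n v \<longleftrightarrow> (\<exists>p. awalk v p u \<and> length p \<le> n)"
proof -
  have "u \<in> hop_ball G n v \<longleftrightarrow> (\<exists>m\<le>n. \<exists>p. awalk v p u \<and> length p = m)"
    by (simp add: hop_ball_def awalk_length_relpow assms)
  then show ?thesis by auto
qed

lemma distance_conv: "distance G u v = (INF p\<in>{p. awalk u p v}. ereal (real (length p)))"
  unfolding distance_def \<mu>_def by (simp add: awalk_cost_def sum_list_triv)

text \<open>Walk lengths are integers, so their infimum is at least \<open>n + 1\<close> exactly
  when no walk has length at most \<open>n\<close>. If there is no walk at all, the infimum is
  \<infinity> and both sides hold.\<close>

lemma distance_ge_Suc_iff:
  assumes "u \<in> verts G"
  shows "distance G u v \<ge> ereal (real (n + 1)) \<longleftrightarrow> v \<notin> hop_ball G n u"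
proof -
  have "ereal (real (n + 1)) \<le> ereal (real (length p)) \<longleftrightarrow> \<not> length p \<le> n" for p :: "'b list" by auto
  then show ?thesis
    unfolding distance_conv le_INF_iff using hop_ball_iff_awalk[OF assms] by auto
qed

lemma distance_le_iff:
  assumes "u \<in> verts G"
  shows "distance G u v \<le> ereal (real n) \<longleftrightarrow> v \<in> hop_ball G n u"
proof
  assume "v \<in> hop_ball G n u"
  then obtain p where "awalk u p v" "length p \<le> n" using hop_ball_iff_awalk[OF assms] by blast
  then show "distance G u v \<le> ereal (real n)" unfolding distance_conv by (intro INF_lower2[of p]) auto
next
  assume "distance G u v \<le> ereal (real n)"
  then have "\<not> distance G u v \<ge> ereal (real (n + 1))" using order_trans by fastforce
  then show "v \<in> hop_ball G n u" using distance_ge_Suc_iff[OF assms] by blast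
qed

lemma ball_graph_eq: "v \<in> verts G \<Longrightarrow> ball_graph G n v = G \<restriction> hop_ball G n v"
  using hop_ball_subset_verts[of v n]
  by (auto simp: ball_graph_def distance_le_iff intro!: arg_cong[of _ _ "(\<restriction>) G"])

lemma apart_iff:
  "apart n G S \<longleftrightarrow> S \<subseteq> verts G \<and> (\<forall>u\<in>S. \<forall>v\<in>S. u \<noteq> v \<longrightarrow> v \<notin> hop_ball G n u)"
  unfolding apart_def using distance_ge_Suc_iff by (meson subsetD)

end

section \<open>Parents and spheres in a tree\<close>

lemma is_treeD:
  assumes "is_tree T"
  shows "sym_digraph T" "loopfree_digraph T" "nomulti_digraph T" "verts T \<noteq> {}"
    "u \<in> verts T \<Longrightarrow> v \<in> verts T \<Longrightarrow> u \<rightarrow>\<^sup>*\<^bsub>T\<^esub> v"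
proof -
  show *: "sym_digraph T" "loopfree_digraph T" "nomulti_digraph T"
    using assms by (auto simp: is_tree_def simple_graph_def)
  interpret sym_digraph T by fact
  have sc: "strongly_connected (mk_symmetric T)" using assms by (simp add: is_tree_def connected_def)
  then show "verts T \<noteq> {}" by (simp add: strongly_connected_def)
  show "u \<rightarrow>\<^sup>*\<^bsub>T\<^esub> v" if "u \<in> verts T" "v \<in> verts T"
    using sc that reachable_mk_symmetric_eq[OF sym_arcs, of u v] by (simp add: strongly_connected_def)
qed

text \<open>Two such neighbours would close a cycle through \<open>w\<close>.\<close>
lemma tree_unique_neighbor_in_connected_set:
  assumes T: "is_tree T" and S: "S \<subseteq> verts T" "\<And>x y. x \<in> S \<Longrightarrow> y \<in> S \<Longrightarrow> x \<rightarrow>\<^sup>*\<^bsub>T \<restriction> S\<^esub> y"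
    and w: "w \<notin> S" and ab: "a \<in> S" "b \<in> S" "a \<in> neighbors T w" "b \<in> neighbors T w"
  shows "a = b"
proof (rule ccontr)
  assume neq: "a \<noteq> b"
  interpret sym_digraph T using T by (rule is_treeD)
  interpret S: wf_digraph "T \<restriction> S" by (rule wellformed_induce_subgraph)
  obtain p where p: "S.apath a p b" using S(2)[OF ab(1,2)] S.reachable_apath by blast
  then have p': "S.awalk a p b" "distinct (S.awalk_verts a p)" by (auto simp: S.apath_def)
  have sub: "subgraph (T \<restriction> S) T" using S(1) by (rule subgraph_induce_subgraphI)
  have pT: "awalk a p b" using p'(1) sub by (simp add: subgraph_awalk_imp_awalk)
  have verts_eq: "S.awalk_verts a p = awalk_verts a p"
    using compatible_awalk_verts[OF compatible_induce_subgraph] by metis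
  have "set (S.awalk_verts a p) \<subseteq> S" using S.awalkE'[OF p'(1)] by auto
  then have w': "w \<notin> set (awalk_verts a p)" using w verts_eq by auto
  obtain e where e: "e \<in> arcs T" "tail T e = w" "head T e = a"
    using ab(3) by (auto simp: neighbors_def)
  have "b \<rightarrow>\<^bsub>T\<^esub> w" using ab(4) sym_arcs by (auto simp: neighbors_def arcs_ends_symmetric)
  then obtain e' where e': "e' \<in> arcs T" "tail T e' = b" "head T e' = w" by auto
  let ?c = "e # p @ [e']"
  have walk: "awalk w ?c w"
    using e e' pT by (auto simp: awalk_Cons_iff awalk_Nil_iff)
  have "tl (awalk_verts w ?c) = awalk_verts a p @ [w]"
    using e e' pT awalk_verts_append[of a p "[e']" w] by (auto simp: awalk_Cons_iff awalk_Nil_iff)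
  then have "distinct (tl (awalk_verts w ?c))" using p'(2) verts_eq w' by simp
  then have "cycle ?c" using walk unfolding cycle_def by blast
  moreover have "p \<noteq> []" using pT neq by (auto simp: awalk_Nil_iff)
  then have "length ?c \<ge> 3" by (cases p) auto
  ultimately show False using T unfolding is_tree_def by blast
qed

text \<open>A shortest way from the centre passes through smaller balls and so never leaves this
  one. The result supplies the connectivity required by
  \<open>tree_unique_neighbor_in_connected_set\<close>.\<close>

lemma (in sym_digraph) hop_ball_connected:
  assumes "v \<in> verts G" "x \<in> hop_ball G n v" "y \<in> hop_ball G n v"
  shows "x \<rightarrow>\<^sup>*\<^bsub>G \<restriction> hop_ball G n v\<^esub> y"
proof -
  let ?B = "G \<restriction> hop_ball G n v"
  interpret B: wf_digraph ?B by (rule wellformed_induce_subgraph)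
  have adj: "x \<rightarrow>\<^bsub>?B\<^esub> y" if "x \<in> hop_ball G n v" "y \<in> hop_ball G n v" "x \<rightarrow>\<^bsub>G\<^esub> y" for x y
    using that by (auto simp: arcs_ends_conv)
  have "symmetric ?B"
    unfolding symmetric_def
  proof (rule symI)
    fix x y assume xy: "x \<rightarrow>\<^bsub>?B\<^esub> y"
    then have "x \<in> hop_ball G n v" "y \<in> hop_ball G n v" by (auto simp: arcs_ends_conv)
    moreover have "y \<rightarrow>\<^bsub>G\<^esub> x"
      using dominates_induce_subgraphD[OF xy] sym_arcs by (rule arcs_ends_symmetric[rotated])
    ultimately show "y \<rightarrow>\<^bsub>?B\<^esub> x" by (intro adj)
  qed
  have "v \<rightarrow>\<^sup>*\<^bsub>?B\<^esub> x" if "m \<le> n" "x \<in> hop_ball G m v" for m x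
    using that
  proof (induction m arbitrary: x)
    case (Suc m)
    show ?case
    proof (cases "x \<in> hop_ball G m v")
      case False
      then obtain y where y: "y \<in> hop_ball G m v" "y \<rightarrow>\<^bsub>G\<^esub> x"
        using Suc.prems by (auto simp: hop_ball_Suc neighbors_def)
      then have "y \<rightarrow>\<^bsub>?B\<^esub> x"
        using adj hop_ball_mono[of m n G v] hop_ball_mono[of "Suc m" n G v] Suc.prems by auto
      then show ?thesis using Suc.IH[OF _ y(1)] Suc.prems(1) B.reachable_adj_trans by auto
    qed (use Suc in auto)
  qed auto
  then show ?thesis
    using assms(2,3) symmetric_reachable[OF \<open>symmetric ?B\<close>] B.reachable_trans by blast
qed

lemma tree_unique_parent:
  assumes T: "is_tree T" and v: "v \<in> verts T"
    and w: "w \<notin> hop_ball T n v"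
    and ab: "a \<in> hop_ball T n v" "b \<in> hop_ball T n v" "a \<in> neighbors T w" "b \<in> neighbors T w"
  shows "a = b"
proof -
  interpret sym_digraph T using T by (rule is_treeD)
  show ?thesis
    using tree_unique_neighbor_in_connected_set[OF T hop_ball_subset_verts[OF v] hop_ball_connected[OF v] w ab] .
qed

text \<open>The ball stays connected when \<open>w'\<close> is attached to it through its parent
  \<open>b\<close>. An edge from \<open>w\<close> to \<open>w'\<close> would give \<open>w\<close>
  two neighbours in this connected set, namely \<open>w'\<close> and its own parent
  \<open>a\<close>.\<close>

lemma tree_no_edge_in_sphere:
  assumes T: "is_tree T" and v: "v \<in> verts T"
    and w: "w \<notin> hop_ball T n v" "w \<in> hop_ball T (Suc n) v"
    and w': "w' \<notin> hop_ball T n v" "w' \<in> hop_ball T (Suc n) v"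
  shows "w' \<notin> neighbors T w"
proof
  assume adj: "w' \<in> neighbors T w"
  interpret sym_digraph T using T by (rule is_treeD)
  interpret loopfree_digraph T using T by (rule is_treeD)
  let ?B = "hop_ball T n v"
  let ?S = "insert w' ?B"
  have nsym: "x \<in> neighbors T y \<longleftrightarrow> y \<in> neighbors T x" for x y
    using sym_arcs by (auto simp: neighbors_def arcs_ends_symmetric)
  obtain a where a: "a \<in> ?B" "a \<in> neighbors T w" using w nsym by (auto simp: hop_ball_Suc)
  obtain b where b: "b \<in> ?B" "b \<in> neighbors T w'" using w' nsym by (auto simp: hop_ball_Suc)
  have S: "?S \<subseteq> verts T"
    using hop_ball_subset_verts[OF v, of n] hop_ball_subset_verts[OF v, of "Suc n"] w' by auto
  interpret S: wf_digraph "T \<restriction> ?S" by (rule wellformed_induce_subgraph)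
  have edge: "x \<rightarrow>\<^sup>*\<^bsub>T \<restriction> ?S\<^esub> y" if "x \<in> ?S" "y \<in> ?S" "y \<in> neighbors T x" for x y
    using that by (intro S.reachable_adjI) (auto simp: arcs_ends_conv neighbors_def)
  have "subgraph (T \<restriction> ?B) (T \<restriction> ?S)"
    using S by (auto simp: subgraph_def compatible_def wellformed_induce_subgraph)
  then have inB: "x \<rightarrow>\<^sup>*\<^bsub>T \<restriction> ?S\<^esub> y" if "x \<in> ?B" "y \<in> ?B" for x y
    using that hop_ball_connected[OF v that] S.reachable_mono by blast
  have conn: "x \<rightarrow>\<^sup>*\<^bsub>T \<restriction> ?S\<^esub> b \<and> b \<rightarrow>\<^sup>*\<^bsub>T \<restriction> ?S\<^esub> x" if "x \<in> ?S" for x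
    using that inB edge[of b w'] edge[of w' b] b nsym by auto
  have conn2: "x \<rightarrow>\<^sup>*\<^bsub>T \<restriction> ?S\<^esub> y" if "x \<in> ?S" "y \<in> ?S" for x y
    using conn[OF that(1)] conn[OF that(2)] S.reachable_trans by blast
  have "w \<noteq> w'" using adj by (auto simp: neighbors_def dest: adj_not_same)
  then have "w \<notin> ?S" using w by auto
  then have "a = w'"
    using tree_unique_neighbor_in_connected_set[OF T S conn2 _ _ _ a(2) adj] a(1) by blast
  then show False using a(1) w'(1) by simp
qed

section \<open>Pushing test functions forward\<close>

text \<open>The form of the subgraph induced on \<open>S\<close>, written as a sum over
  \<open>T\<close> so that functions on nested balls can be compared directly.\<close>

definition restricted_form :: "('v, 'e) pre_digraph \<Rightarrow> 'v set \<Rightarrow> ('v \<Rightarrow> real) \<Rightarrow> real" where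
  "restricted_form T S f = (\<Sum>x\<in>S. \<Sum>y\<in>neighbors T x \<inter> S. f x * f y)"

definition pushforward :: "'v set \<Rightarrow> ('v \<Rightarrow> 'w) \<Rightarrow> ('v \<Rightarrow> real) \<Rightarrow> 'w \<Rightarrow> real" where
  "pushforward S \<pi> f w = L2_set f {x \<in> S. \<pi> x = w}"

lemma pushforward_nonzero_iff:
  "finite S \<Longrightarrow> pushforward S \<pi> f w \<noteq> 0 \<longleftrightarrow> (\<exists>x\<in>S. \<pi> x = w \<and> f x \<noteq> 0)"
  by (auto simp: pushforward_def L2_set_eq_0_iff)

lemma sum_pushforward_squares:
  assumes "finite S" "finite V" "\<pi> ` S \<subseteq> V"
  shows "(\<Sum>w\<in>V. (pushforward S \<pi> f w)\<^sup>2) = (\<Sum>x\<in>S. (f x)\<^sup>2)"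
proof -
  have "(\<Sum>w\<in>V. (pushforward S \<pi> f w)\<^sup>2) = (\<Sum>w\<in>V. \<Sum>x\<in>{x \<in> S. \<pi> x = w}. (f x)\<^sup>2)"
    by (simp add: pushforward_def L2_set_def sum_nonneg)
  then show ?thesis using sum.group[OF assms, of "\<lambda>x. (f x)\<^sup>2"] by simp
qed

text \<open>
  Local injectivity makes the edges of \<open>T\<close> over an edge \<open>(w, w')\<close> of \<open>G\<close> a partial matching between
  the fibres of \<open>w\<close> and \<open>w'\<close>, so that the Cauchy-Schwarz inequality applies edge by edge.
\<close>
lemma restricted_form_le_graph_form_pushforward:
  assumes T: "sym_digraph T" and G: "graph G"
    and S: "finite S" "\<pi> ` S \<subseteq> verts G"
    and hom: "\<And>x y. x \<in> S \<Longrightarrow> y \<in> S \<Longrightarrow> y \<in> neighbors T x \<Longrightarrow> \<pi> y \<in> neighbors G (\<pi> x)"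
    and inj: "\<And>x. x \<in> S \<Longrightarrow> inj_on \<pi> (neighbors T x \<inter> S)"
  shows "restricted_form T S f \<le> graph_form G (pushforward S \<pi> f)"
proof -
  interpret T: sym_digraph T by fact
  interpret G: graph G by fact
  define P where "P = (SIGMA x:S. neighbors T x \<inter> S)"
  define Q where "Q = (SIGMA u:verts G. neighbors G u)"
  define q where "q = (\<lambda>(x, y). (\<pi> x, \<pi> y))"
  have fin_nb: "finite (neighbors G u)" for u
    using G.neighbors_subset_verts G.finite_verts by (rule finite_subset)
  have P: "finite P" and Q: "finite Q" and PQ: "q ` P \<subseteq> Q"
    using S hom fin_nb by (auto simp: P_def Q_def q_def)
  have fibre: "(\<Sum>e\<in>{e \<in> P. q e = (u, w)}. f (fst e) * f (snd e))
      \<le> pushforward S \<pi> f u * pushforward S \<pi> f w" for u w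
  proof -
    let ?E = "{e \<in> P. q e = (u, w)}"
    have fst: "inj_on fst ?E" "fst ` ?E \<subseteq> {x \<in> S. \<pi> x = u}"
      using inj by (auto simp: inj_on_def P_def q_def)
    \<comment> \<open>Two edges with the same second end \<open>y\<close> have first ends that are
      both neighbours of \<open>y\<close> and have the same image, so local injectivity at
      \<open>y\<close> applies. This is where the symmetry of \<open>T\<close> enters.\<close>
    have snd: "inj_on snd ?E" "snd ` ?E \<subseteq> {x \<in> S. \<pi> x = w}"
      using inj T.neighbors_sym by (auto simp: inj_on_def P_def q_def)
    have fib: "L2_set (f \<circ> h) ?E \<le> pushforward S \<pi> f v"
      if "inj_on h ?E" "h ` ?E \<subseteq> {x \<in> S. \<pi> x = v}" for h v
    proof -
      have "(\<Sum>e\<in>?E. (f (h e))\<^sup>2) = (\<Sum>x\<in>h ` ?E. (f x)\<^sup>2)"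
        using that(1) by (simp add: sum.reindex)
      also have "\<dots> \<le> (\<Sum>x\<in>{x \<in> S. \<pi> x = v}. (f x)\<^sup>2)"
        using that(2) S(1) by (intro sum_mono2) auto
      finally show ?thesis by (simp add: pushforward_def L2_set_def)
    qed
    have "(\<Sum>e\<in>?E. f (fst e) * f (snd e)) \<le> (\<Sum>e\<in>?E. \<bar>(f \<circ> fst) e\<bar> * \<bar>(f \<circ> snd) e\<bar>)"
      by (intro sum_mono) (simp add: abs_mult[symmetric])
    also have "\<dots> \<le> L2_set (f \<circ> fst) ?E * L2_set (f \<circ> snd) ?E" by (rule L2_set_mult_ineq)
    also have "\<dots> \<le> pushforward S \<pi> f u * pushforward S \<pi> f w"
      using fib[OF fst] fib[OF snd] by (intro mult_mono) (auto simp: pushforward_def)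
    finally show ?thesis .
  qed
  have "restricted_form T S f = (\<Sum>e\<in>P. f (fst e) * f (snd e))"
    unfolding restricted_form_def P_def using S(1) by (subst sum.Sigma) (auto simp: case_prod_unfold)
  also have "\<dots> = (\<Sum>z\<in>Q. \<Sum>e\<in>{e \<in> P. q e = z}. f (fst e) * f (snd e))"
    using sum.group[OF P Q PQ, of "\<lambda>e. f (fst e) * f (snd e)"] by simp
  also have "\<dots> \<le> (\<Sum>z\<in>Q. pushforward S \<pi> f (fst z) * pushforward S \<pi> f (snd z))"
  proof (rule sum_mono)
    fix z show "(\<Sum>e\<in>{e \<in> P. q e = z}. f (fst e) * f (snd e))
        \<le> pushforward S \<pi> f (fst z) * pushforward S \<pi> f (snd z)"
      using fibre[of "fst z" "snd z"] by simp
  qed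
  also have "\<dots> = graph_form G (pushforward S \<pi> f)"
    unfolding graph_form_def Q_def using fin_nb by (subst sum.Sigma) (auto simp: case_prod_unfold)
  finally show ?thesis .
qed

section \<open>Separated test functions\<close>

lemma (in nomulti_digraph) card_neighbors: "card (neighbors G u) = out_degree G u"
proof -
  have "neighbors G u = head G ` out_arcs G u"
    by (auto simp: neighbors_def arcs_ends_conv image_iff)
  moreover have "inj_on (head G) (out_arcs G u)"
    by (rule inj_onI) (auto simp: arc_to_ends_def intro: no_multi_arcs)
  ultimately show ?thesis by (simp add: out_degree_def card_image)
qed

lemma (in graph) finite_neighbors: "finite (neighbors G u)"
  using neighbors_subset_verts finite_verts by (rule finite_subset)

text \<open>On the span of the functions \<open>g v\<close> both the norm and the form are sums over
  \<open>S\<close> without mixed terms, so the lower bound for each \<open>g v\<close> passes to all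
  their combinations.\<close>

lemma (in graph) card_apart_le_eigenvalue_count:
  assumes S: "apart (2 * r + 1) G S"
    and g: "\<And>v. v \<in> S \<Longrightarrow> \<exists>u\<in>verts G. g v u \<noteq> 0"
      "\<And>v u. v \<in> S \<Longrightarrow> g v u \<noteq> 0 \<Longrightarrow> u \<in> hop_ball G r v"
      "\<And>v. v \<in> S \<Longrightarrow> graph_form G (g v) \<ge> b * (\<Sum>u\<in>verts G. (g v u)\<^sup>2)"
  shows "card S \<le> size {#x \<in># graph_eigenvalues G. x \<ge> b#}"
proof -
  have SV: "S \<subseteq> verts G" and far: "\<And>u v. u \<in> S \<Longrightarrow> v \<in> S \<Longrightarrow> u \<noteq> v \<Longrightarrow> v \<notin> hop_ball G (2 * r + 1) u"
    using S unfolding apart_iff by auto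
  have finS: "finite S" using SV by (rule finite_subset) simp
  \<comment> \<open>If both factors were nonzero, \<open>v'\<close> could be reached from
    \<open>v\<close> in \<open>r + 1 + r\<close> steps, the middle one being the possible step from
    \<open>u\<close> to \<open>w\<close>.\<close>
  have disj: "g v u * g v' w = 0" if "v \<in> S" "v' \<in> S" "v \<noteq> v'" "w \<in> insert u (neighbors G u)" for u w v v'
  proof (rule ccontr)
    assume "g v u * g v' w \<noteq> 0"
    then have "u \<in> hop_ball G r v" "w \<in> hop_ball G r v'" using g(2) that(1,2) by auto
    moreover have "w \<in> hop_ball G 1 u" using that(4) by (auto simp: hop_ball_Suc)
    ultimately have "v' \<in> hop_ball G (r + 1 + r) v"
      by (meson hop_ball_trans hop_ball_sym)
    then show False using far[OF that(1-3)] by (simp add: mult_2 add.commute add.left_commute)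
  qed
  \<comment> \<open>The case \<open>w = u\<close> serves the norm and linear independence, the case
    of adjacent \<open>w\<close> the form.\<close>
  have prod: "(\<Sum>v\<in>S. x v * g v u) * (\<Sum>v\<in>S. x v * g v w) = (\<Sum>v\<in>S. (x v)\<^sup>2 * (g v u * g v w))"
    if "w \<in> insert u (neighbors G u)" for u w x
  proof -
    have "(\<Sum>v\<in>S. x v * g v u) * (\<Sum>v\<in>S. x v * g v w) =
        (\<Sum>v\<in>S. \<Sum>v'\<in>S. if v' = v then (x v)\<^sup>2 * (g v u * g v w) else 0)"
      unfolding sum_product
    proof (intro sum.cong refl)
      fix v v' assume "v \<in> S" "v' \<in> S"
      then show "x v * g v u * (x v' * g v' w) = (if v' = v then (x v)\<^sup>2 * (g v u * g v w) else 0)"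
        using disj[of v v' w u] that by (auto simp: power2_eq_square)
    qed
    then show ?thesis using finS by simp
  qed
  show ?thesis
  proof (rule card_le_eigenvalue_count[OF finS, of g])
    fix x :: "'a \<Rightarrow> real"
    assume "\<exists>v\<in>S. x v \<noteq> 0"
    then obtain v where v: "v \<in> S" "x v \<noteq> 0" by blast
    then obtain u where u: "u \<in> verts G" "g v u \<noteq> 0" using g(1) by blast
    have "(\<Sum>v\<in>S. (x v)\<^sup>2 * (g v u * g v u)) > 0"
      using finS v u by (intro sum_pos2[of _ v]) (auto simp: zero_less_mult_iff)
    then have "(\<Sum>v\<in>S. x v * g v u) \<noteq> 0" using prod[of u u x] by auto
    then show "\<exists>u\<in>verts G. (\<Sum>v\<in>S. x v * g v u) \<noteq> 0" using u by blast
  next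
    fix x :: "'a \<Rightarrow> real"
    have "b * (\<Sum>u\<in>verts G. (\<Sum>v\<in>S. x v * g v u)\<^sup>2) =
        b * (\<Sum>u\<in>verts G. \<Sum>v\<in>S. (x v)\<^sup>2 * (g v u)\<^sup>2)"
      by (simp add: power2_eq_square[of "sum _ _"] prod) (simp add: power2_eq_square)
    also have "\<dots> = (\<Sum>v\<in>S. (x v)\<^sup>2 * (b * (\<Sum>u\<in>verts G. (g v u)\<^sup>2)))"
      by (subst sum.swap) (simp add: sum_distrib_left mult_ac)
    also have "\<dots> \<le> (\<Sum>v\<in>S. (x v)\<^sup>2 * graph_form G (g v))"
      using g(3) by (intro sum_mono mult_left_mono) auto
    also have "\<dots> = (\<Sum>u\<in>verts G. \<Sum>w\<in>neighbors G u. \<Sum>v\<in>S. (x v)\<^sup>2 * (g v u * g v w))"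
      unfolding graph_form_def sum_distrib_left
      by (subst sum.swap) (intro sum.cong refl sum.swap)
    also have "\<dots> = graph_form G (\<lambda>u. \<Sum>v\<in>S. x v * g v u)"
      unfolding graph_form_def by (intro sum.cong refl) (simp add: prod)
    finally show "b * (\<Sum>u\<in>verts G. (\<Sum>v\<in>S. x v * g v u)\<^sup>2) \<le> graph_form G (\<lambda>u. \<Sum>v\<in>S. x v * g v u)" .
  qed
qed

section \<open>Apart sets of maximum size\<close>

lemma (in graph) finite_apart_cards: "finite {card S |S. apart r G S}"
proof (rule finite_subset)
  show "{card S |S. apart r G S} \<subseteq> {..card (verts G)}"
    by (auto simp: apart_def intro: card_mono)
qed simp

lemma (in graph) apart_number_attained:
  obtains S where "apart r G S" "card S = apart_number r G"
proof -
  have "apart r G {}" by (simp add: apart_def)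
  then have "{card S |S. apart r G S} \<noteq> {}" by blast
  then have "apart_number r G \<in> {card S |S. apart r G S}"
    unfolding apart_number_def by (rule Max_in[OF finite_apart_cards])
  then show ?thesis using that by auto
qed

text \<open>A vertex outside all the balls about a largest apart set could be added to that set. The
  balls therefore cover the graph, and each has at most \<open>Suc d ^ r\<close> vertices.\<close>

lemma (in graph) card_verts_le_apart:
  assumes deg: "\<And>u. u \<in> verts G \<Longrightarrow> out_degree G u \<le> d"
  obtains S where "apart r G S" "card (verts G) \<le> card S * Suc d ^ r"
proof -
  obtain S where S: "apart r G S" "card S = apart_number r G" by (rule apart_number_attained)
  then have SV: "S \<subseteq> verts G" by (simp add: apart_iff)
  then have finS: "finite S" by (rule finite_subset) simp
  have nb: "card (neighbors G u) \<le> d" for u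
  proof (cases "u \<in> verts G")
    case False
    then have "neighbors G u = {}" by (auto simp: neighbors_def adj_in_verts)
    then show ?thesis by simp
  qed (simp add: card_neighbors deg)
  have "verts G \<subseteq> (\<Union>v\<in>S. hop_ball G r v)"
  proof
    fix u assume u: "u \<in> verts G"
    show "u \<in> (\<Union>v\<in>S. hop_ball G r v)"
    proof (rule ccontr)
      assume not: "u \<notin> (\<Union>v\<in>S. hop_ball G r v)"
      then have "u \<notin> hop_ball G r v" "v \<notin> hop_ball G r u" if "v \<in> S" for v
        using that hop_ball_sym[of v r u] by auto
      then have "apart r G (insert u S)" using S(1) u unfolding apart_iff by simp
      then have "card (insert u S) \<in> {card S |S. apart r G S}" by blast
      then have "card (insert u S) \<le> apart_number r G"
        unfolding apart_number_def by (rule Max_ge[OF finite_apart_cards])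
      moreover have "u \<notin> S" using not self_in_hop_ball[of u G r] by blast
      ultimately show False using S(2) finS by simp
    qed
  qed
  then have "card (verts G) \<le> card (\<Union>v\<in>S. hop_ball G r v)"
    using finS finite_hop_ball[OF finite_neighbors] by (intro card_mono) auto
  also have "\<dots> \<le> (\<Sum>v\<in>S. card (hop_ball G r v))" by (rule card_UN_le[OF finS])
  also have "\<dots> \<le> card S * Suc d ^ r"
    using sum_bounded_above[of S "\<lambda>v. card (hop_ball G r v)" "Suc d ^ r"]
      card_hop_ball_le[OF finite_neighbors nb] by simp
  finally show ?thesis using S(1) that by blast
qed

section \<open>The spectral radius of a tree\<close>

lemma graph_induce_subgraph:
  assumes "sym_digraph T" "loopfree_digraph T" "nomulti_digraph T" "finite S"
  shows "graph (T \<restriction> S)"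
proof -
  interpret sym_digraph T by fact
  interpret loopfree_digraph T by fact
  interpret nomulti_digraph T by fact
  \<comment> \<open>A finite vertex set alone does not bound the number of arcs; the absence of
    parallel arcs embeds them into \<open>S \<times> S\<close>.\<close>
  have fin: "finite (arcs (T \<restriction> S))"
  proof (rule inj_on_finite)
    show "inj_on (arc_to_ends T) (arcs (T \<restriction> S))"
      using inj_on_arc_to_ends by (rule inj_on_subset) auto
    show "arc_to_ends T ` arcs (T \<restriction> S) \<subseteq> S \<times> S" by (auto simp: arc_to_ends_def)
  qed (use assms(4) in simp)
  have "sym (arcs_ends (T \<restriction> S))"
  proof (rule symI)
    fix x y assume xy: "x \<rightarrow>\<^bsub>T \<restriction> S\<^esub> y"
    then have "x \<in> S" "y \<in> S" by (auto simp: arcs_ends_conv)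
    moreover have "y \<rightarrow>\<^bsub>T\<^esub> x"
      using dominates_induce_subgraphD[OF xy] sym_arcs by (rule arcs_ends_symmetric[rotated])
    ultimately show "y \<rightarrow>\<^bsub>T \<restriction> S\<^esub> x" by (auto simp: arcs_ends_conv)
  qed
  moreover have "e1 = e2" if "e1 \<in> arcs T" "e2 \<in> arcs T" "tail T e1 = tail T e2" "head T e1 = head T e2" for e1 e2
    using that no_multi_arcs by (simp add: arc_to_ends_def)
  ultimately show ?thesis
    using fin assms(4) no_loops by unfold_locales (auto simp: symmetric_def arc_to_ends_def)
qed

lemma neighbors_induce_subgraph: "x \<in> S \<Longrightarrow> neighbors (T \<restriction> S) x = neighbors T x \<inter> S"
  by (auto simp: neighbors_def arcs_ends_conv)

lemma graph_form_induce_subgraph: "graph_form (T \<restriction> S) f = restricted_form T S f"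
  by (simp add: graph_form_def restricted_form_def neighbors_induce_subgraph)

lemma restricted_form_extend_by_zero:
  assumes "finite S'" "S \<subseteq> S'"
  shows "restricted_form T S' (\<lambda>x. if x \<in> S then f x else 0) = restricted_form T S f"
proof -
  let ?f = "\<lambda>x. if x \<in> S then f x else 0"
  have "restricted_form T S' ?f = (\<Sum>x\<in>S. \<Sum>y\<in>neighbors T x \<inter> S'. ?f x * ?f y)"
    unfolding restricted_form_def using assms by (intro sum.mono_neutral_right) auto
  also have "\<dots> = (\<Sum>x\<in>S. \<Sum>y\<in>neighbors T x \<inter> S. f x * f y)"
  proof (rule sum.cong[OF refl])
    fix x assume "x \<in> S"
    have "(\<Sum>y\<in>neighbors T x \<inter> S'. ?f x * ?f y) = (\<Sum>y\<in>neighbors T x \<inter> S. ?f x * ?f y)"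
      using assms by (intro sum.mono_neutral_right) auto
    also have "\<dots> = (\<Sum>y\<in>neighbors T x \<inter> S. f x * f y)"
      using \<open>x \<in> S\<close> by (intro sum.cong) auto
    finally show "(\<Sum>y\<in>neighbors T x \<inter> S'. ?f x * ?f y) = (\<Sum>y\<in>neighbors T x \<inter> S. f x * f y)" .
  qed
  finally show ?thesis by (simp add: restricted_form_def)
qed

text \<open>Follows the two cases of \<open>graph_rho\<close>, with the same chosen root
  \<open>v\<close>. In a finite tree some ball is the whole tree. In an infinite one the largest
  eigenvalues \<open>a n\<close> of the balls increase, by extending test functions by zero, and are
  bounded by \<open>d\<close>; so the \<open>lim\<close> is a genuine limit and some ball comes
  within \<epsilon> of it.\<close>

lemma graph_rho_approx:
  assumes T: "is_tree T" and fin: "\<And>x. finite (neighbors T x)" and deg: "\<And>x. card (neighbors T x) \<le> d"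
    and \<epsilon>: "\<epsilon> > 0"
  defines "v \<equiv> SOME v. v \<in> verts T"
  shows "\<exists>n f. (\<exists>x\<in>hop_ball T n v. f x \<noteq> 0) \<and>
    restricted_form T (hop_ball T n v) f \<ge> (graph_rho T - \<epsilon>) * (\<Sum>x\<in>hop_ball T n v. (f x)\<^sup>2)"
proof -
  interpret sym_digraph T using T by (rule is_treeD)
  have v: "v \<in> verts T" unfolding v_def using is_treeD(4)[OF T] by (simp add: some_in_eq)
  define B where "B n = hop_ball T n v" for n
  have finB: "finite (B n)" for n unfolding B_def by (rule finite_hop_ball) (rule fin)
  have graphB: "graph (T \<restriction> B n)" for n
    by (intro graph_induce_subgraph is_treeD[OF T] finB)
  have vB: "v \<in> B n" for n by (simp add: B_def)
  define a where "a n = largest_eigenvalue (T \<restriction> B n)" for n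
  have attained: "\<exists>f. (\<exists>x\<in>B n. f x \<noteq> 0) \<and> restricted_form T (B n) f = a n * (\<Sum>x\<in>B n. (f x)\<^sup>2)" for n
  proof -
    interpret B: graph "T \<restriction> B n" by (rule graphB)
    have "verts (T \<restriction> B n) \<noteq> {}" using vB by auto
    then obtain f where "\<exists>x\<in>verts (T \<restriction> B n). f x \<noteq> 0"
      "graph_form (T \<restriction> B n) f = largest_eigenvalue (T \<restriction> B n) * (\<Sum>x\<in>verts (T \<restriction> B n). (f x)\<^sup>2)"
      by (rule B.largest_eigenvalue_attained)
    then show ?thesis by (auto simp: graph_form_induce_subgraph a_def)
  qed
  show ?thesis
  proof (cases "finite (verts T)")
    case True
    have "\<exists>n. x \<in> B n" if x: "x \<in> verts T" for x
    proof -
      have "v \<rightarrow>\<^sup>*\<^bsub>T\<^esub> x" using is_treeD(5)[OF T v x] .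
      then obtain p where "awalk v p x" using reachable_awalk by blast
      then show ?thesis unfolding B_def hop_ball_iff_awalk[OF v] by blast
    qed
    then obtain k where k: "\<And>x. x \<in> verts T \<Longrightarrow> x \<in> B (k x)" by metis
    \<comment> \<open>Connectedness places each vertex in some ball about \<open>v\<close>;
      finiteness provides one radius that is large enough for all.\<close>
    define n where "n = Max (k ` verts T)"
    have "B n = verts T"
    proof
      show "B n \<subseteq> verts T" unfolding B_def by (rule hop_ball_subset_verts[OF v])
      show "verts T \<subseteq> B n"
      proof
        fix x assume x: "x \<in> verts T"
        then have "k x \<le> n" unfolding n_def using True by (intro Max_ge) auto
        then show "x \<in> B n" using k[OF x] subsetD[OF hop_ball_mono] unfolding B_def by metis
      qed
    qed
    moreover have "{e \<in> arcs T. tail T e \<in> verts T \<and> head T e \<in> verts T} = arcs T"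
      using tail_in_verts head_in_verts by blast
    then have "T \<restriction> verts T = T" by (intro pre_digraph.equality) simp_all
    ultimately have "T \<restriction> B n = T" by simp
    then have "graph_rho T = a n" using True by (simp add: graph_rho_def a_def)
    moreover obtain f where "\<exists>x\<in>B n. f x \<noteq> 0" "restricted_form T (B n) f = a n * (\<Sum>x\<in>B n. (f x)\<^sup>2)"
      using attained by blast
    moreover have "\<epsilon> * (\<Sum>x\<in>B n. (f x)\<^sup>2) \<ge> 0" using \<epsilon> by (simp add: sum_nonneg)
    ultimately show ?thesis unfolding B_def by (intro exI[of _ n] exI[of _ f]) (simp add: left_diff_distrib)
  next
    case False
    have "a n \<le> a (Suc n)" for n
    proof -
      obtain f where f: "\<exists>x\<in>B n. f x \<noteq> 0" "restricted_form T (B n) f = a n * (\<Sum>x\<in>B n. (f x)\<^sup>2)"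
        using attained by blast
      interpret B: graph "T \<restriction> B (Suc n)" by (rule graphB)
      have sub: "B n \<subseteq> B (Suc n)" unfolding B_def by (rule hop_ball_mono) simp
      let ?f = "\<lambda>x. if x \<in> B n then f x else 0"
      have "(\<Sum>x\<in>B (Suc n). (?f x)\<^sup>2) = (\<Sum>x\<in>B n. (f x)\<^sup>2)"
        using finB sub by (intro sum.mono_neutral_cong_right) auto
      moreover have "\<exists>x\<in>B (Suc n). ?f x \<noteq> 0" using f(1) sub by auto
      ultimately show ?thesis
        unfolding a_def[of "Suc n"] using f(2)
        by (intro B.largest_eigenvalue_ge[of ?f])
          (auto simp: graph_form_induce_subgraph restricted_form_extend_by_zero[OF finB sub])
    qed
    then have "incseq a" by (rule incseq_SucI)
    moreover have "a n \<le> d" for n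
    proof -
      interpret B: graph "T \<restriction> B n" by (rule graphB)
      have "card (neighbors (T \<restriction> B n) x) \<le> d" if "x \<in> B n" for x
        using that card_mono[OF fin, of "neighbors T x \<inter> B n" x] deg[of x]
        by (simp add: neighbors_induce_subgraph)
      then show ?thesis unfolding a_def using vB by (intro B.largest_eigenvalue_le_degree) auto
    qed
    ultimately obtain L where L: "a \<longlonglongrightarrow> L"
      using incseq_convergent[of a "real d"] by blast
    have "graph_rho T = lim (\<lambda>r. largest_eigenvalue (ball_graph T r v))"
      using False by (simp add: graph_rho_def v_def)
    also have "\<dots> = lim a" by (simp add: ball_graph_eq[OF v] a_def[abs_def] B_def)
    finally have "graph_rho T = L" using L limI by metis
    then have "\<forall>\<^sub>F n in sequentially. a n > graph_rho T - \<epsilon>"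
      using order_tendstoD(1)[OF L] \<epsilon> by simp
    then obtain n where n: "a n > graph_rho T - \<epsilon>" by (auto simp: eventually_sequentially)
    obtain f where f: "\<exists>x\<in>B n. f x \<noteq> 0" "restricted_form T (B n) f = a n * (\<Sum>x\<in>B n. (f x)\<^sup>2)"
      using attained by blast
    have "(graph_rho T - \<epsilon>) * (\<Sum>x\<in>B n. (f x)\<^sup>2) \<le> a n * (\<Sum>x\<in>B n. (f x)\<^sup>2)"
      using n by (intro mult_right_mono sum_nonneg) auto
    then show ?thesis using f unfolding B_def by (intro exI[of _ n] exI[of _ f]) simp
  qed
qed

section \<open>Typed maps between balls of a tree\<close>

text \<open>The partition in \<^const>\<open>degree_matrix_of\<close>, encoded by the map from vertices to class indices.\<close>
definition vertex_typing :: "nat mat \<Rightarrow> ('v, 'e) pre_digraph \<Rightarrow> ('v \<Rightarrow> nat) \<Rightarrow> bool" where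
  "vertex_typing D T c \<longleftrightarrow>
     (\<forall>x\<in>verts T. c x < dim_row D) \<and> (\<forall>i<dim_row D. \<exists>x\<in>verts T. c x = i) \<and>
     (\<forall>x\<in>verts T. \<forall>j<dim_row D. finite {y \<in> neighbors T x. c y = j} \<and>
        card {y \<in> neighbors T x. c y = j} = D $$ (c x, j))"

lemma degree_matrix_of_iff:
  assumes "wf_digraph T"
  shows "degree_matrix_of D T \<longleftrightarrow> (\<exists>c. vertex_typing D T c)"
proof
  interpret wf_digraph T by fact
  have nbV: "neighbors T x \<subseteq> verts T" for x by (rule neighbors_subset_verts)
  {
    assume "degree_matrix_of D T"
    then obtain U where U: "(\<Union>i<dim_row D. U i) = verts T" "\<And>i. i < dim_row D \<Longrightarrow> U i \<noteq> {}"
      "\<And>i j. i < dim_row D \<Longrightarrow> j < dim_row D \<Longrightarrow> i \<noteq> j \<Longrightarrow> U i \<inter> U j = {}"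
      "\<And>i j v. i < dim_row D \<Longrightarrow> j < dim_row D \<Longrightarrow> v \<in> U i \<Longrightarrow>
         finite (neighbors T v \<inter> U j) \<and> card (neighbors T v \<inter> U j) = D $$ (i, j)"
      unfolding degree_matrix_of_def by metis
    have "\<forall>x\<in>verts T. \<exists>i<dim_row D. x \<in> U i" using U(1) by blast
    then obtain c where c: "\<And>x. x \<in> verts T \<Longrightarrow> c x < dim_row D \<and> x \<in> U (c x)" by metis
    have eq: "c x = i \<longleftrightarrow> x \<in> U i" if "x \<in> verts T" "i < dim_row D" for x i
      using c[OF that(1)] U(3)[of "c x" i] that(2) by auto
    have nb: "{y \<in> neighbors T x. c y = j} = neighbors T x \<inter> U j" if "j < dim_row D" for x j
      using nbV[of x] eq that by auto
    have ne: "\<exists>x\<in>verts T. c x = i" if "i < dim_row D" for i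
    proof -
      obtain x where "x \<in> U i" using U(2) \<open>i < dim_row D\<close> by blast
      moreover then have "x \<in> verts T" using U(1) \<open>i < dim_row D\<close> by blast
      ultimately show ?thesis using eq \<open>i < dim_row D\<close> by blast
    qed
    have "finite {y \<in> neighbors T x. c y = j} \<and> card {y \<in> neighbors T x. c y = j} = D $$ (c x, j)"
      if x: "x \<in> verts T" and j: "j < dim_row D" for x j
      using U(4)[of "c x" j x] c[OF x] j by (simp add: nb)
    then show "\<exists>c. vertex_typing D T c"
      unfolding vertex_typing_def using c ne by (intro exI[of _ c]) simp
  }
  {
    assume "\<exists>c. vertex_typing D T c"
    then obtain c where c: "\<And>x. x \<in> verts T \<Longrightarrow> c x < dim_row D" "\<And>i. i < dim_row D \<Longrightarrow> \<exists>x\<in>verts T. c x = i"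
      "\<And>x j. x \<in> verts T \<Longrightarrow> j < dim_row D \<Longrightarrow> finite {y \<in> neighbors T x. c y = j} \<and>
        card {y \<in> neighbors T x. c y = j} = D $$ (c x, j)"
      unfolding vertex_typing_def by blast
    have nb: "neighbors T x \<inter> {y \<in> verts T. c y = j} = {y \<in> neighbors T x. c y = j}" for x j
      using nbV[of x] by auto
    show "degree_matrix_of D T"
      unfolding degree_matrix_of_def
      by (intro exI[of _ "\<lambda>i. {y \<in> verts T. c y = i}"])
        (use c in \<open>auto simp: nb\<close>)
  }
qed

text \<open>The degree of a vertex is the row sum belonging to its type. The sum of all entries is a
  crude bound that is the same for every \<open>x\<close>.\<close>

lemma vertex_typing_finite_neighbors:
  assumes "wf_digraph T" "vertex_typing D T c"
  shows "finite (neighbors T x)"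
    and "card (neighbors T x) \<le> (\<Sum>i<dim_row D. \<Sum>j<dim_row D. D $$ (i, j))"
proof -
  interpret wf_digraph T by fact
  have "finite (neighbors T x) \<and> card (neighbors T x) \<le> (\<Sum>i<dim_row D. \<Sum>j<dim_row D. D $$ (i, j))"
  proof (cases "x \<in> verts T")
    case True
    have eq: "neighbors T x = (\<Union>j<dim_row D. {y \<in> neighbors T x. c y = j})"
      using neighbors_subset_verts[of x] assms(2) by (auto simp: vertex_typing_def)
    have fin: "\<And>j. j \<in> {..<dim_row D} \<Longrightarrow> finite {y \<in> neighbors T x. c y = j}"
      using assms(2) True by (auto simp: vertex_typing_def)
    have "card (neighbors T x) \<le> (\<Sum>j<dim_row D. card {y \<in> neighbors T x. c y = j})"
      by (subst eq) (rule card_UN_le, simp)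
    also have "\<dots> = (\<Sum>j<dim_row D. D $$ (c x, j))"
      using assms(2) True by (intro sum.cong) (auto simp: vertex_typing_def)
    also have "\<dots> \<le> (\<Sum>i<dim_row D. \<Sum>j<dim_row D. D $$ (i, j))"
      using assms(2) True by (intro member_le_sum[of "c x" _ "\<lambda>i. \<Sum>j<dim_row D. D $$ (i, j)"])
        (auto simp: vertex_typing_def)
    moreover have "finite (neighbors T x)" using fin by (subst eq) blast
    ultimately show ?thesis by simp
  next
    case False
    then have "neighbors T x = {}" by (auto simp: neighbors_def adj_in_verts)
    then show ?thesis by simp
  qed
  then show "finite (neighbors T x)"
    and "card (neighbors T x) \<le> (\<Sum>i<dim_row D. \<Sum>j<dim_row D. D $$ (i, j))" by auto
qed

text \<open>
  The set \<open>P\<close> has at most one element. When a map is extended from a ball of a tree to the next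
  larger one, it contains the parent of \<open>x\<close>, whose image is already fixed.
\<close>
lemma neighbors_typed_injection:
  assumes wf: "wf_digraph T" and c: "vertex_typing D T c"
    and xy: "x \<in> verts T" "y \<in> verts T" "c x = c y"
    and P: "P \<subseteq> neighbors T x" "\<And>a a'. a \<in> P \<Longrightarrow> a' \<in> P \<Longrightarrow> a = a'"
      "\<And>a. a \<in> P \<Longrightarrow> p a \<in> neighbors T y \<and> c (p a) = c a"
  obtains h where "inj_on h (neighbors T x)" "h ` neighbors T x \<subseteq> neighbors T y"
    "\<And>z. z \<in> neighbors T x \<Longrightarrow> c (h z) = c z" "\<And>a. a \<in> P \<Longrightarrow> h a = p a"
proof -
  interpret wf_digraph T by fact
  let ?N = "\<lambda>x j. {z \<in> neighbors T x. c z = j}"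
  have fin: "finite (?N x j)" "finite (?N y j)" and card_eq: "card (?N x j) = card (?N y j)"
    if "j < dim_row D" for j
    using c xy that unfolding vertex_typing_def by auto
  have "\<exists>h. bij_betw h (?N x j) (?N y j) \<and> (\<forall>a\<in>P. c a = j \<longrightarrow> h a = p a)" if j: "j < dim_row D" for j
  proof (cases "\<exists>a\<in>P. c a = j")
    case True
    then obtain a where a: "a \<in> P" "c a = j" by blast
    \<comment> \<open>The value at \<open>a\<close> is prescribed, so \<open>a\<close> and
      \<open>p a\<close> are set aside, the remaining sets of equal size are matched, and the pair
      is put back.\<close>
    define A where "A = ?N x j - {a}"
    define C where "C = ?N y j - {p a}"
    have mem: "a \<in> ?N x j" "p a \<in> ?N y j" using a P by auto
    then have "card A = card C" "finite A" "finite C"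
      using card_eq[OF j] fin[OF j] unfolding A_def C_def by (simp_all add: card_Diff_singleton)
    then obtain h where h: "inj_on h A" "h ` A = C"
      using finite_same_card_bij[of A C] by (auto simp: bij_betw_def)
    have "(h(a := p a)) ` A = h ` A" by (intro image_cong) (auto simp: A_def)
    moreover have "inj_on (h(a := p a)) A"
      using h(1) by (subst inj_on_cong[of A _ h]) (auto simp: A_def)
    moreover have "a \<notin> A" "p a \<notin> C" by (simp_all add: A_def C_def)
    ultimately have "bij_betw (h(a := p a)) (insert a A) (insert (p a) C)"
      using h(2) by (simp add: bij_betw_def)
    moreover have "insert a A = ?N x j" "insert (p a) C = ?N y j"
      using mem unfolding A_def C_def by blast+
    ultimately have "bij_betw (h(a := p a)) (?N x j) (?N y j)" by simp
    moreover have "\<forall>b\<in>P. (h(a := p a)) b = p b" using P(2)[OF _ a(1)] by simp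
    ultimately show ?thesis by blast
  next
    case False
    then show ?thesis using finite_same_card_bij[OF fin[OF j] card_eq[OF j]] by blast
  qed
  then have "\<forall>j. \<exists>h. j < dim_row D \<longrightarrow> bij_betw h (?N x j) (?N y j) \<and> (\<forall>a\<in>P. c a = j \<longrightarrow> h a = p a)"
    by blast
  from choice[OF this] obtain h where h: "\<And>j. j < dim_row D \<Longrightarrow> bij_betw (h j) (?N x j) (?N y j)"
    "\<And>j a. j < dim_row D \<Longrightarrow> a \<in> P \<Longrightarrow> c a = j \<Longrightarrow> h j a = p a" by blast
  have ty: "c z < dim_row D" if "z \<in> neighbors T x" for z
    using c that neighbors_subset_verts[of x] unfolding vertex_typing_def by blast
  have img: "h (c z) z \<in> ?N y (c z)" if "z \<in> neighbors T x" for z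
    using bij_betwE[OF h(1)[OF ty[OF that]]] that by blast
  show ?thesis
  proof (rule that[of "\<lambda>z. h (c z) z"])
    show "inj_on (\<lambda>z. h (c z) z) (neighbors T x)"
    proof (rule inj_onI)
      fix z z' assume z: "z \<in> neighbors T x" "z' \<in> neighbors T x" "h (c z) z = h (c z') z'"
      then have eq: "c z = c z'" using img[OF z(1)] img[OF z(2)] by simp
      have "inj_on (h (c z)) (?N x (c z))" using h(1)[OF ty[OF z(1)]] by (rule bij_betw_imp_inj_on)
      then show "z = z'" using z eq by (auto dest: inj_onD)
    qed
  qed (use img h(2) ty P(1) in auto)
qed

text \<open>Induction on the radius. A vertex on the boundary has only its parent inside the ball,
  so equality of types leaves room to map its neighbours injectively while the image of the parent
  is kept. Uniqueness of parents makes these choices compatible, and the absence of edges within a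
  sphere means that nothing else has to be checked.\<close>

lemma tree_ball_typed_hom:
  assumes T: "is_tree T" and c: "vertex_typing D T c"
    and v: "v \<in> verts T" and y: "y \<in> verts T" "c y = c v"
  shows "\<exists>\<phi>. \<phi> v = y \<and> (\<forall>x\<in>hop_ball T n v. \<phi> x \<in> verts T \<and> c (\<phi> x) = c x) \<and>
    (\<forall>x\<in>hop_ball T n v. \<forall>z\<in>hop_ball T n v. z \<in> neighbors T x \<longrightarrow> \<phi> z \<in> neighbors T (\<phi> x)) \<and>
    (\<forall>x\<in>hop_ball T n v. inj_on \<phi> (neighbors T x \<inter> hop_ball T n v))"
proof (induction n)
  interpret sym_digraph T using T by (rule is_treeD)
  interpret loopfree_digraph T using T by (rule is_treeD)
  case 0
  have "v \<notin> neighbors T v" by (auto simp: neighbors_def dest: adj_not_same)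
  then show ?case using v y by (intro exI[of _ "\<lambda>_. y"]) auto
next
  interpret sym_digraph T using T by (rule is_treeD)
  interpret loopfree_digraph T using T by (rule is_treeD)
  case (Suc n)
  let ?B = "hop_ball T n v" and ?B' = "hop_ball T (Suc n) v"
  obtain \<phi> where \<phi>: "\<phi> v = y" "\<And>x. x \<in> ?B \<Longrightarrow> \<phi> x \<in> verts T" "\<And>x. x \<in> ?B \<Longrightarrow> c (\<phi> x) = c x"
    "\<And>x z. x \<in> ?B \<Longrightarrow> z \<in> ?B \<Longrightarrow> z \<in> neighbors T x \<Longrightarrow> \<phi> z \<in> neighbors T (\<phi> x)"
    "\<And>x. x \<in> ?B \<Longrightarrow> inj_on \<phi> (neighbors T x \<inter> ?B)"
    using Suc.IH by blast
  have BV: "?B \<subseteq> verts T" by (rule hop_ball_subset_verts[OF v])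
  have B'V: "?B' \<subseteq> verts T" by (rule hop_ball_subset_verts[OF v])
  have sub: "?B \<subseteq> ?B'" by (rule hop_ball_mono) simp
  have nbB': "neighbors T x \<subseteq> ?B'" if "x \<in> ?B" for x using that by (auto simp: hop_ball_Suc)
  \<comment> \<open>Admissible values on the neighbours of \<open>x\<close>. A choice is needed only
    where \<open>x\<close> has a neighbour outside the old ball.\<close>
  define h_ok where "h_ok x h \<longleftrightarrow> inj_on h (neighbors T x) \<and> h ` neighbors T x \<subseteq> neighbors T (\<phi> x) \<and>
    (\<forall>z\<in>neighbors T x. c (h z) = c z) \<and> (\<forall>a\<in>neighbors T x \<inter> ?B. h a = \<phi> a)" for x h
  have "\<exists>h. h_ok x h" if x: "x \<in> ?B" "\<not> neighbors T x \<subseteq> ?B" for x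
  proof -
    obtain z where z: "z \<in> neighbors T x" "z \<notin> ?B" using x(2) by blast
    \<comment> \<open>A vertex with a neighbour outside the ball of radius \<open>Suc m\<close> is
      not in the ball of radius \<open>m\<close>. It thus lies on the outermost sphere, where an
      edge into the ball can only lead to the parent.\<close>
    have uniq: "a = a'" if "a \<in> neighbors T x \<inter> ?B" "a' \<in> neighbors T x \<inter> ?B" for a a'
    proof (cases n)
      case 0
      then show ?thesis using that by simp
    next
      case (Suc m)
      have xm: "x \<notin> hop_ball T m v"
        using z Suc by (auto simp: hop_ball_Suc)
      have "b \<in> hop_ball T m v" if b: "b \<in> neighbors T x \<inter> ?B" for b
        using tree_no_edge_in_sphere[OF T v xm _ _ , of b] x(1) b Suc by auto
      then show ?thesis using tree_unique_parent[OF T v xm] that by blast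
    qed
    show ?thesis
    proof (rule neighbors_typed_injection[OF wf_digraph_axioms c _ _ _ , of x "\<phi> x" "neighbors T x \<inter> ?B" \<phi>])
      fix h
      assume "inj_on h (neighbors T x)" "h ` neighbors T x \<subseteq> neighbors T (\<phi> x)"
        "\<And>z. z \<in> neighbors T x \<Longrightarrow> c (h z) = c z" "\<And>a. a \<in> neighbors T x \<inter> ?B \<Longrightarrow> h a = \<phi> a"
      then show "\<exists>h. h_ok x h" unfolding h_ok_def by blast
    qed (use x \<phi> BV uniq in auto)
  qed
  then obtain h where h: "\<And>x. x \<in> ?B \<Longrightarrow> \<not> neighbors T x \<subseteq> ?B \<Longrightarrow> h_ok x (h x)" by metis
  have "\<exists>p\<in>?B. z \<in> neighbors T p" if "z \<in> ?B'" "z \<notin> ?B" for z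
    using that by (auto simp: hop_ball_Suc)
  then obtain p where p: "\<And>z. z \<in> ?B' \<Longrightarrow> z \<notin> ?B \<Longrightarrow> p z \<in> ?B \<and> z \<in> neighbors T (p z)" by metis
  have p_uniq: "p z = x" if "z \<notin> ?B" "x \<in> ?B" "z \<in> neighbors T x" for x z
  proof -
    have "z \<in> ?B'" using that nbB' by blast
    then show ?thesis
      using tree_unique_parent[OF T v that(1), of "p z" x] p[of z] that neighbors_sym by blast
  qed
  \<comment> \<open>A new vertex takes the value proposed by its unique parent
    \<open>p z\<close>.\<close>
  define \<psi> where "\<psi> z = (if z \<in> ?B then \<phi> z else h (p z) z)" for z
  have \<psi>h: "\<psi> z = h x z" if "x \<in> ?B" "\<not> neighbors T x \<subseteq> ?B" "z \<in> neighbors T x" for x z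
    using h[OF that(1,2)] that(3) p_uniq[of z x] that(1) by (auto simp: \<psi>_def h_ok_def)
  have nb_ok: "inj_on \<psi> (neighbors T x) \<and> \<psi> ` neighbors T x \<subseteq> neighbors T (\<phi> x) \<and>
      (\<forall>z\<in>neighbors T x. c (\<psi> z) = c z)" if x: "x \<in> ?B" for x
  proof (cases "neighbors T x \<subseteq> ?B")
    case True
    then have "\<psi> z = \<phi> z" if "z \<in> neighbors T x" for z using that by (auto simp: \<psi>_def)
    moreover have "inj_on \<phi> (neighbors T x)" using \<phi>(5)[OF x] True by (simp add: Int_absorb2)
    ultimately show ?thesis using True \<phi>(3,4) x by (auto simp: inj_on_def)
  next
    case False
    then show ?thesis using h[OF x False] \<psi>h[OF x False] by (auto simp: h_ok_def inj_on_def)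
  qed
  show ?case
  proof (intro exI[of _ \<psi>] conjI ballI impI)
    show "\<psi> v = y" using \<phi>(1) by (simp add: \<psi>_def)
  next
    fix x assume x: "x \<in> ?B'"
    have "\<psi> x \<in> verts T \<and> c (\<psi> x) = c x"
    proof (cases "x \<in> ?B")
      case False
      then have px: "p x \<in> ?B" "x \<in> neighbors T (p x)" using p[OF x] by auto
      then have "\<psi> x \<in> neighbors T (\<phi> (p x))" "c (\<psi> x) = c x" using nb_ok[OF px(1)] by auto
      then show ?thesis using neighbors_subset_verts by blast
    qed (use \<phi> in \<open>auto simp: \<psi>_def\<close>)
    then show "\<psi> x \<in> verts T" "c (\<psi> x) = c x" by auto
    show "inj_on \<psi> (neighbors T x \<inter> ?B')"
    proof (cases "x \<in> ?B")
      case True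
      then show ?thesis using nb_ok by (auto intro: inj_on_subset)
    next
      case False
      \<comment> \<open>On the new sphere the parent is the only neighbour in the larger ball, so
        injectivity there is trivial.\<close>
      have "a = p x" if a: "a \<in> neighbors T x \<inter> ?B'" for a
      proof -
        have "a \<in> ?B" using tree_no_edge_in_sphere[OF T v False x, of a] a by auto
        then show ?thesis using p_uniq[OF False] a neighbors_sym by blast
      qed
      then show ?thesis by (auto simp: inj_on_def)
    qed
    fix z assume z: "z \<in> ?B'" "z \<in> neighbors T x"
    show "\<psi> z \<in> neighbors T (\<psi> x)"
    proof (cases "x \<in> ?B")
      case True
      then show ?thesis using nb_ok[OF True] z by (auto simp: \<psi>_def)
    next
      case False
      then have zB: "z \<in> ?B" using tree_no_edge_in_sphere[OF T v False x, of z] z by auto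
      then have "\<psi> x \<in> neighbors T (\<psi> z)"
        using nb_ok[OF zB] z neighbors_sym[of z x] by (auto simp: \<psi>_def)
      then show ?thesis using neighbors_sym by blast
    qed
  qed
qed

section \<open>The universal cover\<close>

definition type_step :: "nat mat \<Rightarrow> (nat \<times> nat) set" where
  "type_step D = {(i, j). i < dim_row D \<and> j < dim_row D \<and> D $$ (i, j) > 0}"

lemma degree_matrix_connected:
  assumes D: "degree_matrix t D" and ik: "i < t" "k < t"
  shows "(i, k) \<in> (type_step D)\<^sup>*"
proof -
  have t: "dim_row D = t" using D by (auto simp: degree_matrix_def)
  have "\<forall>i<t. \<forall>k<t. \<exists>ms. ms \<noteq> [] \<and> set ms \<subseteq> {..<t} \<and> hd ms = i \<and> last ms = k \<and>
      (\<forall>j. j + 1 < length ms \<longrightarrow> D $$ (ms ! j, ms ! (j + 1)) > 0)"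
    using D unfolding degree_matrix_def by (elim conjE)
  then obtain ms where ms: "ms \<noteq> []" "set ms \<subseteq> {..<t}" "hd ms = i" "last ms = k"
    "\<And>j. j + 1 < length ms \<Longrightarrow> D $$ (ms ! j, ms ! (j + 1)) > 0"
    using ik by blast
  have "j < length ms \<Longrightarrow> (i, ms ! j) \<in> (type_step D)\<^sup>*" for j
  proof (induction j)
    case 0
    then show ?case using ms(1,3) by (simp add: hd_conv_nth)
  next
    case (Suc j)
    then have "ms ! j < t" "ms ! Suc j < t" using ms(2) nth_mem by (metis Suc_lessD lessThan_iff subsetD)+
    then have "(ms ! j, ms ! Suc j) \<in> type_step D" using ms(5)[of j] Suc.prems by (simp add: type_step_def t)
    then show ?case using Suc by (meson Suc_lessD rtrancl.rtrancl_into_rtrancl)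
  qed
  from this[of "length ms - 1"] show ?thesis using ms(1,4) by (simp add: last_conv_nth)
qed

lemma neighbor_of_type:
  assumes "x \<in> verts T" "\<forall>j<dim_row D. finite {y \<in> neighbors T x. c y = j} \<and>
      card {y \<in> neighbors T x. c y = j} = D $$ (c x, j)"
    and "(c x, j) \<in> type_step D"
  obtains y where "y \<in> neighbors T x" "c y = j"
proof -
  have "card {y \<in> neighbors T x. c y = j} > 0" using assms by (auto simp: type_step_def)
  then have "{y \<in> neighbors T x. c y = j} \<noteq> {}" by (metis card.empty less_irrefl)
  then show ?thesis using that by blast
qed

section \<open>An explicit tree with degree matrix \<open>D\<close>\<close>

fun word_type :: "(nat \<times> nat) list \<Rightarrow> nat" where
  "word_type [] = 0"
| "word_type ((j, k) # w) = j"

text \<open>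
  Vertices of the cover are non-backtracking walks from a root of type \<open>0\<close>: the entry
  \<open>(j, k)\<close> leads to the \<open>k\<close>-th neighbour of type \<open>j\<close> other than the predecessor. The last step
  stands at the head of the list.
\<close>
fun cover_word :: "nat mat \<Rightarrow> (nat \<times> nat) list \<Rightarrow> bool" where
  "cover_word D [] \<longleftrightarrow> True"
| "cover_word D ((j, k) # w) \<longleftrightarrow> cover_word D w \<and> j < dim_row D \<and>
     k < D $$ (word_type w, j) - (if w \<noteq> [] \<and> j = word_type (tl w) then 1 else 0)"

definition cover_adj :: "nat mat \<Rightarrow> (nat \<times> nat) list \<Rightarrow> (nat \<times> nat) list \<Rightarrow> bool" where
  "cover_adj D u w \<longleftrightarrow> cover_word D u \<and> cover_word D w \<and> ((\<exists>e. u = e # w) \<or> (\<exists>e. w = e # u))"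

text \<open>Words are encoded as natural numbers because \<open>universal_cover\<close> ranges over
  graphs with vertices of type \<open>nat\<close>.\<close>

definition cover_graph :: "nat mat \<Rightarrow> (nat, nat \<times> nat) pre_digraph" where
  "cover_graph D = \<lparr> verts = to_nat ` {w. cover_word D w},
     arcs = {(to_nat u, to_nat w) | u w. cover_adj D u w}, tail = fst, head = snd \<rparr>"

lemma cover_graph_adj:
  "x \<rightarrow>\<^bsub>cover_graph D\<^esub> y \<longleftrightarrow> (\<exists>u w. x = to_nat u \<and> y = to_nat w \<and> cover_adj D u w)"
  by (auto simp: arcs_ends_conv cover_graph_def)

lemma cover_graph_neighbors: "neighbors (cover_graph D) (to_nat w) = to_nat ` {u. cover_adj D w u}"
  by (auto simp: neighbors_def cover_graph_adj)

lemma simple_cover_graph: "simple_graph (cover_graph D)"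
proof -
  have wf: "wf_digraph (cover_graph D)"
    by unfold_locales (auto simp: cover_graph_def cover_adj_def)
  have "sym (arcs_ends (cover_graph D))"
    by (rule symI) (auto simp: cover_graph_adj cover_adj_def)
  then have "sym_digraph (cover_graph D)"
    using wf by (simp add: sym_digraph_def sym_digraph_axioms_def symmetric_def)
  moreover have "loopfree_digraph (cover_graph D)"
    using wf by (auto simp: loopfree_digraph_def loopfree_digraph_axioms_def cover_graph_def cover_adj_def)
  moreover have "nomulti_digraph (cover_graph D)"
    using wf by (auto simp: nomulti_digraph_def nomulti_digraph_axioms_def cover_graph_def arc_to_ends_def)
  ultimately show ?thesis by (simp add: simple_graph_def)
qed

lemma connected_cover_graph: "connected (cover_graph D)"
proof -
  let ?T = "cover_graph D"
  interpret sym_digraph ?T using simple_cover_graph by (simp add: simple_graph_def)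
  have root: "to_nat w \<rightarrow>\<^sup>*\<^bsub>?T\<^esub> to_nat ([] :: (nat \<times> nat) list)" if "cover_word D w" for w
    using that
  proof (induction w)
    case Nil
    then show ?case by (intro reachable_refl) (auto simp: cover_graph_def)
  next
    case (Cons e w)
    then have w: "cover_word D w" by (cases e) auto
    then have "cover_adj D (e # w) w" using Cons.prems by (simp add: cover_adj_def)
    then have "to_nat (e # w) \<rightarrow>\<^bsub>?T\<^esub> to_nat w" unfolding cover_graph_adj by blast
    then show ?case using Cons.IH[OF w] by (rule adj_reachable_trans)
  qed
  have "x \<rightarrow>\<^sup>*\<^bsub>?T\<^esub> y" if xy: "x \<in> verts ?T" "y \<in> verts ?T" for x y
  proof -
    obtain u w where "cover_word D u" "cover_word D w" "x = to_nat u" "y = to_nat w"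
      using xy by (auto simp: cover_graph_def)
    then show ?thesis using root reachable_trans symmetric_reachable' by metis
  qed
  moreover have "verts ?T \<noteq> {}" by (auto simp: cover_graph_def intro: exI[of _ "[]"])
  ultimately show ?thesis
    unfolding connected_def strongly_connected_def by (simp add: reachable_mk_symmetric_eq[OF sym_arcs])
qed

text \<open>Both cyclic neighbours of a longest word on a cycle would be its tail.\<close>
lemma no_cyclic_cover_words:
  assumes m: "m \<ge> 3" and inj: "inj_on x {..<m}"
    and adj: "\<And>i. i < m \<Longrightarrow> cover_adj D (x i) (x (Suc i mod m))"
  shows False
proof -
  have "finite ((\<lambda>i. length (x i)) ` {..<m})" "(\<lambda>i. length (x i)) ` {..<m} \<noteq> {}"
    using m by (auto simp: lessThan_empty_iff)
  then have "Max ((\<lambda>i. length (x i)) ` {..<m}) \<in> (\<lambda>i. length (x i)) ` {..<m}" by (rule Max_in)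
  then obtain i where i: "i < m" "length (x i) = Max ((\<lambda>i. length (x i)) ` {..<m})" by auto
  have longest: "length (x j) \<le> length (x i)" if "j < m" for j
    unfolding i(2) using that by (intro Max_ge) auto
  define j where "j = Suc i mod m"
  \<comment> \<open>The cyclic predecessor of \<open>i\<close>, whereas \<open>j\<close> is its
    successor; they differ because \<open>m \<ge> 3\<close>.\<close>
  define k where "k = (if i = 0 then m - 1 else i - 1)"
  have jk: "j < m" "k < m" "Suc k mod m = i" "j \<noteq> k"
    using m i(1) by (auto simp: j_def k_def mod_Suc)
  have "x j = tl (x i)"
    using adj[OF i(1)] longest[OF jk(1)] by (auto simp: cover_adj_def j_def)
  moreover have "x k = tl (x i)"
    using adj[OF jk(2)] longest[OF jk(2)] by (auto simp: cover_adj_def jk(3))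
  ultimately have "x j = x k" by simp
  then show False using inj_onD[OF inj, of j k] jk(1,2,4) by simp
qed

lemma (in pre_digraph) cas_consecutive:
  "cas u p v \<Longrightarrow> Suc i < length p \<Longrightarrow> tail G (p ! Suc i) = head G (p ! i)"
proof (induction p arbitrary: u i)
  case (Cons e p)
  then show ?case by (cases i; cases p) auto
qed simp

text \<open>The distinctness in \<open>cycle\<close> concerns the vertices after the starting point,
  that is, the heads of the arcs. The sequence \<open>x\<close> of tails is the same list shifted
  cyclically by one place.\<close>

lemma (in wf_digraph) cycle_vertex_sequence:
  assumes "cycle p"
  obtains x where "inj_on x {..<length p}" "\<And>i. i < length p \<Longrightarrow> x i \<rightarrow> x (Suc i mod length p)"
proof -
  obtain u where u: "awalk u p u" "distinct (tl (awalk_verts u p))" "p \<noteq> []"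
    using assms unfolding cycle_def by blast
  then have cas: "cas u p u" "set p \<subseteq> arcs G" by (auto simp: awalk_def)
  define x where "x i = tail G (p ! i)" for i
  let ?m = "length p"
  have head: "head G (p ! i) = x (Suc i mod ?m)" if i: "i < ?m" for i
  proof (cases "Suc i = ?m")
    case True
    then have "p ! i = last p" using u(3) by (metis diff_Suc_1 last_conv_nth)
    moreover have "head G (last p) = u" "tail G (p ! 0) = u"
      using cas(1) u(1,3) by (auto simp: awalk_verts_conv cas_simp hd_conv_nth dest!: awlast_of_awalk)
    ultimately show ?thesis using True by (simp add: x_def)
  next
    case False
    then show ?thesis using i cas_consecutive[OF cas(1), of i] by (simp add: x_def)
  qed
  have "tl (awalk_verts u p) = map (head G) p"
    using awalk_verts_conv'[OF cas(1)] u(3) by simp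
  then have dist: "distinct (map (head G) p)" using u(2) by simp
  have "inj_on x {..<?m}"
  proof (rule inj_onI)
    fix i j assume ij: "i \<in> {..<?m}" "j \<in> {..<?m}" "x i = x j"
    define pred where "pred i = (if i = 0 then ?m - 1 else i - 1)" for i
    have pred: "pred i < ?m" "Suc (pred i) mod ?m = i" if "i < ?m" for i
      using that by (auto simp: pred_def)
    have "head G (p ! pred i) = head G (p ! pred j)"
      using ij head[of "pred i"] head[of "pred j"] pred by simp
    then have "pred i = pred j"
      using dist ij pred(1) by (simp add: distinct_conv_nth) blast
    then show "i = j" using pred(2) ij by (metis lessThan_iff)
  qed
  moreover have "x i \<rightarrow> x (Suc i mod ?m)" if "i < ?m" for i
  proof -
    have "p ! i \<in> arcs G" using cas(2) that by auto
    then have "x i \<rightarrow> head G (p ! i)" unfolding x_def by (rule in_arcs_imp_in_arcs_ends)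
    then show ?thesis by (simp only: head[OF that])
  qed
  ultimately show ?thesis using that by blast
qed

lemma is_tree_cover_graph: "is_tree (cover_graph D)"
proof -
  let ?T = "cover_graph D"
  interpret sym_digraph ?T using simple_cover_graph by (simp add: simple_graph_def)
  have False if p: "cycle p" "length p \<ge> 3" for p
  proof -
    let ?m = "length p"
    obtain x where x: "inj_on x {..<?m}" "\<And>i. i < ?m \<Longrightarrow> x i \<rightarrow>\<^bsub>?T\<^esub> x (Suc i mod ?m)"
      using cycle_vertex_sequence[OF p(1)] by metis
    define y where "y i = (from_nat (x i) :: (nat \<times> nat) list)" for i
    have y: "x i = to_nat (y i)" if "i < ?m" for i
      using x(2)[OF that] unfolding cover_graph_adj by (auto simp: y_def)
    have "inj_on y {..<?m}" using x(1) y by (auto simp: inj_on_def)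
    moreover have "cover_adj D (y i) (y (Suc i mod ?m))" if "i < ?m" for i
      using x(2)[OF that] unfolding cover_graph_adj y_def by auto
    ultimately show False using no_cyclic_cover_words[OF p(2)] by blast
  qed
  then show ?thesis using simple_cover_graph connected_cover_graph by (auto simp: is_tree_def)
qed

text \<open>The neighbours of type \<open>j\<close> of a word are its one-letter extensions, whose
  number was reduced by one exactly when the predecessor has type \<open>j\<close>, together with
  that predecessor. The two corrections cancel.\<close>

lemma degree_matrix_of_cover_graph:
  assumes D: "degree_matrix t D"
  shows "degree_matrix_of D (cover_graph D)"
proof -
  let ?T = "cover_graph D"
  have t: "dim_row D = t" "t > 0" and D1: "\<And>i j. i < t \<Longrightarrow> j < t \<Longrightarrow> D $$ (i, j) = 0 \<Longrightarrow> D $$ (j, i) = 0"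
    using D by (auto simp: degree_matrix_def)
  interpret sym_digraph ?T using simple_cover_graph by (simp add: simple_graph_def)
  have ty: "word_type w < t" if "cover_word D w" for w
    using that t by (cases w) auto
  define c where "c x = word_type (from_nat x)" for x
  have count: "finite {u. cover_adj D w u \<and> word_type u = j} \<and>
      card {u. cover_adj D w u \<and> word_type u = j} = D $$ (word_type w, j)"
    if w: "cover_word D w" and j: "j < t" for w j
  proof -
    define \<delta> :: nat where "\<delta> = (if w \<noteq> [] \<and> j = word_type (tl w) then 1 else 0)"
    let ?children = "(\<lambda>k. (j, k) # w) ` {..<D $$ (word_type w, j) - \<delta>}"
    let ?parent = "if \<delta> = 1 then {tl w} else {}"
    \<comment> \<open>The subtraction on natural numbers must not be truncated. A predecessor of
      type \<open>j\<close> was left along a positive entry from \<open>j\<close> to the type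
      \<open>i\<close> of \<open>w\<close>, and (D1) makes the entry from \<open>i\<close> back to
      \<open>j\<close> positive too.\<close>
    have "\<delta> \<le> D $$ (word_type w, j)"
    proof (cases "\<delta> = 1")
      case True
      then obtain i k w' where w': "w = (i, k) # w'" "j = word_type w'" "i < t"
        using w t by (cases w) (auto simp: \<delta>_def split: if_splits)
      have "cover_word D ((i, k) # w')" using w w'(1) by simp
      then have "k < D $$ (word_type w', i)" unfolding cover_word.simps by linarith
      then have "D $$ (word_type w', i) \<noteq> 0" by linarith
      then have "D $$ (j, i) \<noteq> 0" using w'(2) by simp
      then have "D $$ (i, j) \<noteq> 0" using D1[of i j] w'(3) j by auto
      then show ?thesis using True w'(1) by simp
    next
      case False
      moreover have "\<delta> = 0 \<or> \<delta> = 1" by (simp add: \<delta>_def)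
      ultimately show ?thesis by simp
    qed
    moreover have "{u. cover_adj D w u \<and> word_type u = j} = ?children \<union> ?parent"
    proof (intro equalityI subsetI)
      fix u assume "u \<in> {u. cover_adj D w u \<and> word_type u = j}"
      then have u: "cover_adj D w u" "word_type u = j" by auto
      then consider e where "w = e # u" | k where "u = (j, k) # w"
        by (auto simp: cover_adj_def)
      then show "u \<in> ?children \<union> ?parent"
      proof cases
        case 2
        then have "k < D $$ (word_type w, j) - \<delta>" using u(1) unfolding \<delta>_def by (auto simp: cover_adj_def)
        then show ?thesis using 2 by auto
      qed (use u in \<open>simp add: \<delta>_def\<close>)
    next
      fix u assume "u \<in> ?children \<union> ?parent"
      then show "u \<in> {u. cover_adj D w u \<and> word_type u = j}"
      proof
        assume "u \<in> ?children"
        then obtain k where k: "u = (j, k) # w" "k < D $$ (word_type w, j) - \<delta>" by auto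
        then have "cover_word D u" using w j t unfolding \<delta>_def by simp
        then show ?thesis using k w by (simp add: cover_adj_def)
      next
        assume "u \<in> ?parent"
        then have u: "u = tl w" "w \<noteq> []" "j = word_type (tl w)" by (auto simp: \<delta>_def split: if_splits)
        then have wt: "word_type u = j" by simp
        obtain e where e: "w = e # u" using u(1,2) by (metis list.collapse)
        have "cover_word D (e # u)" using w by (simp only: e)
        then have "cover_word D u" by (cases e) simp
        then show ?thesis using wt e w unfolding cover_adj_def by blast
      qed
    qed
    moreover have "card (?children \<union> ?parent) = card ?children + card ?parent"
    proof (rule card_Un_disjoint)
      show "?children \<inter> ?parent = {}"
      proof (rule ccontr)
        assume "?children \<inter> ?parent \<noteq> {}"
        then obtain u where "u \<in> ?children" "u \<in> ?parent" by blast
        then obtain k where "(j, k) # w = tl w" by (auto split: if_splits)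
        then have "length ((j, k) # w) = length (tl w)" by simp
        then show False by simp
      qed
    qed auto
    moreover have "card ?children = D $$ (word_type w, j) - \<delta>"
      by (subst card_image) (auto simp: inj_on_def)
    moreover have "card ?parent = \<delta>" by (auto simp: \<delta>_def)
    ultimately show ?thesis by simp
  qed
  have verts: "verts ?T = to_nat ` {w. cover_word D w}" by (simp add: cover_graph_def)
  have deg: "\<forall>j<dim_row D. finite {y \<in> neighbors ?T x. c y = j} \<and>
      card {y \<in> neighbors ?T x. c y = j} = D $$ (c x, j)" if x: "x \<in> verts ?T" for x
  proof (intro allI impI)
    fix j assume j: "j < dim_row D"
    obtain w where w: "cover_word D w" "x = to_nat w" using x verts by auto
    have eq: "{y \<in> neighbors ?T x. c y = j} = to_nat ` {u. cover_adj D w u \<and> word_type u = j}"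
      unfolding w(2) cover_graph_neighbors by (auto simp: c_def)
    show "finite {y \<in> neighbors ?T x. c y = j} \<and> card {y \<in> neighbors ?T x. c y = j} = D $$ (c x, j)"
      unfolding eq using count[OF w(1), of j] j t(1) by (simp add: card_image c_def w(2))
  qed
  have lt: "c x < dim_row D" if "x \<in> verts ?T" for x
    using that ty by (auto simp: verts c_def t)
  \<comment> \<open>Classes of the partition must be nonempty: by (D2) every type can be reached
    from the root type \<open>0\<close>, and each positive entry on the way is realized by an edge
    of the tree.\<close>
  have "\<exists>x\<in>verts ?T. c x = i" if i: "(0, i) \<in> (type_step D)\<^sup>*" for i
    using i
  proof (induction rule: rtrancl_induct)
    case base
    show ?case by (intro bexI[of _ "to_nat ([] :: (nat \<times> nat) list)"]) (auto simp: c_def verts)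
  next
    case (step i j)
    then obtain x where x: "x \<in> verts ?T" "c x = i" by blast
    then obtain y where "y \<in> neighbors ?T x" "c y = j"
      using neighbor_of_type[OF x(1) deg[OF x(1)]] step(2) by blast
    then show ?case using neighbors_subset_verts by blast
  qed
  then have "vertex_typing D ?T c"
    unfolding vertex_typing_def using lt deg degree_matrix_connected[OF D t(2)] by (simp add: t)
  then show ?thesis using degree_matrix_of_iff[OF wf_digraph_axioms] by blast
qed

section \<open>The chosen universal cover\<close>

text \<open>\<open>cover_graph D\<close> is the witness that makes the choice in
  \<open>universal_cover\<close> meaningful.\<close>

lemma universal_cover_is_tree:
  assumes "degree_matrix t D"
  shows "is_tree (universal_cover D)" "degree_matrix_of D (universal_cover D)"
proof -
  have "\<exists>T :: (nat, nat \<times> nat) pre_digraph. is_tree T \<and> degree_matrix_of D T"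
    using is_tree_cover_graph degree_matrix_of_cover_graph[OF assms] by blast
  from someI_ex[OF this] show "is_tree (universal_cover D)" "degree_matrix_of D (universal_cover D)"
    unfolding universal_cover_def by auto
qed

text \<open>A walk of types along positive entries can be lifted to the tree from any vertex of its
  initial type. There are finitely many initial types, so the longest of the chosen walks gives a
  uniform \<open>s\<close>.\<close>

lemma vertex_of_type_nearby:
  assumes T: "wf_digraph T" and c: "vertex_typing D T c" and D: "degree_matrix t D" and i: "i < t"
  shows "\<exists>s. \<forall>x\<in>verts T. \<exists>y\<in>verts T. y \<in> hop_ball T s x \<and> c y = i"
proof -
  interpret wf_digraph T by fact
  have t: "dim_row D = t" using D by (auto simp: degree_matrix_def)
  have steps: "(c x, k) \<in> type_step D ^^ m \<Longrightarrow> x \<in> verts T \<Longrightarrow> \<exists>y\<in>hop_ball T m x. c y = k" for x k m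
  proof (induction m arbitrary: k)
    case (Suc m)
    then obtain j where j: "(c x, j) \<in> type_step D ^^ m" "(j, k) \<in> type_step D" by auto
    then obtain y where y: "y \<in> hop_ball T m x" "c y = j" using Suc by blast
    then have "y \<in> verts T" using hop_ball_subset_verts[OF Suc.prems(2)] by blast
    then obtain z where "z \<in> neighbors T y" "c z = k"
      using neighbor_of_type[of y T D c k] c y j(2) by (auto simp: vertex_typing_def)
    then show ?case using y by (auto simp: hop_ball_Suc)
  qed auto
  have "\<forall>k. \<exists>m. k < t \<longrightarrow> (k, i) \<in> type_step D ^^ m"
    using degree_matrix_connected[OF D _ i] by (meson rtrancl_imp_relpow)
  from choice[OF this] obtain m where m: "\<And>k. k < t \<Longrightarrow> (k, i) \<in> type_step D ^^ m k" by blast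
  have "\<exists>y\<in>verts T. y \<in> hop_ball T (Max (m ` {..<t})) x \<and> c y = i" if x: "x \<in> verts T" for x
  proof -
    have cx: "c x < t" using c x by (simp add: vertex_typing_def t)
    then obtain y where y: "y \<in> hop_ball T (m (c x)) x" "c y = i" using steps[OF m x] by blast
    have "m (c x) \<le> Max (m ` {..<t})" using cx by (intro Max_ge) auto
    then have "y \<in> hop_ball T (Max (m ` {..<t})) x" using subsetD[OF hop_ball_mono y(1)] by blast
    then show ?thesis using y(2) hop_ball_subset_verts[OF x] by blast
  qed
  then show ?thesis by blast
qed

section \<open>Eigenvalues of graphs with a given subdegree matrix\<close>

text \<open>
  The universal cover carries a finitely supported function with Rayleigh quotient close to \<open>\<rho>\<close>
  around its root. The ball supporting it is copied to a vertex of the root's type close to a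
  preimage of \<open>v\<close>, and then pushed forward to \<open>G\<close>.
\<close>
lemma subdegree_matrix_local_test_function:
  fixes D :: "nat mat"
  assumes D: "degree_matrix t D" and \<epsilon>: "\<epsilon> > 0"
  shows "\<exists>r. \<forall>G :: ('v, 'e) pre_digraph. graph G \<longrightarrow> subdegree_matrix D G \<longrightarrow> (\<forall>v\<in>verts G. \<exists>g.
    (\<exists>u\<in>verts G. g u \<noteq> 0) \<and> (\<forall>u. g u \<noteq> 0 \<longrightarrow> u \<in> hop_ball G r v) \<and>
    graph_form G g \<ge> (graph_rho (universal_cover D) - \<epsilon>) * (\<Sum>u\<in>verts G. (g u)\<^sup>2))"
proof -
  let ?T = "universal_cover D"
  let ?\<rho> = "graph_rho ?T - \<epsilon>"
  have T: "is_tree ?T" using D by (rule universal_cover_is_tree)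
  interpret T: sym_digraph ?T using T by (rule is_treeD)
  have wf: "wf_digraph ?T" by (rule T.wf_digraph_axioms)
  obtain c where c: "vertex_typing D ?T c"
    using universal_cover_is_tree(2)[OF D] degree_matrix_of_iff[OF wf] by blast
  define z where "z = (SOME z. z \<in> verts ?T)"
  have z: "z \<in> verts ?T" unfolding z_def using is_treeD(4)[OF T] by (simp add: some_in_eq)
  obtain n f where f: "\<exists>x\<in>hop_ball ?T n z. f x \<noteq> 0"
    "restricted_form ?T (hop_ball ?T n z) f \<ge> ?\<rho> * (\<Sum>x\<in>hop_ball ?T n z. (f x)\<^sup>2)"
    using graph_rho_approx[OF T vertex_typing_finite_neighbors[OF wf c] \<epsilon>] unfolding z_def by blast
  define S where "S = hop_ball ?T n z"
  have finS: "finite S" unfolding S_def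
    by (rule finite_hop_ball) (rule vertex_typing_finite_neighbors[OF wf c])
  have "D \<in> carrier_mat t t" using D unfolding degree_matrix_def by (elim conjE)
  then have "c z < t" using c z by (auto simp: vertex_typing_def)
  then obtain s where s: "\<forall>x\<in>verts ?T. \<exists>y\<in>verts ?T. y \<in> hop_ball ?T s x \<and> c y = c z"
    by (rule exE[OF vertex_of_type_nearby[OF wf c D]])
  show ?thesis
  \<comment> \<open>At most \<open>s\<close> steps lead from a preimage of \<open>v\<close> to the
    centre of the copied ball, and \<open>n\<close> is the radius of that ball; neither depends on
    \<open>G\<close> or \<open>\<pi>\<close>.\<close>
  proof (intro exI[of _ "s + n"] allI impI ballI)
    fix G :: "('v, 'e) pre_digraph" and v
    assume G: "graph G" and sub: "subdegree_matrix D G" and v: "v \<in> verts G"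
    interpret G: graph G by fact
    obtain \<pi> where \<pi>: "locally_injective_hom ?T G \<pi>" and "v \<in> \<pi> ` verts ?T"
      using sub v unfolding subdegree_matrix_def by (elim conjE) (drule (1) bspec, elim exE conjE)
    then obtain x where x: "x \<in> verts ?T" "\<pi> x = v" by (elim imageE) simp
    have \<pi>V: "\<pi> a \<in> verts G" if "a \<in> verts ?T" for a
      using \<pi> that by (simp add: locally_injective_hom_def)
    have \<pi>_hom: "\<pi> a \<rightarrow>\<^bsub>G\<^esub> \<pi> b" if "a \<rightarrow>\<^bsub>?T\<^esub> b" for a b
      using \<pi> that by (simp add: locally_injective_hom_def)
    have \<pi>_inj: "inj_on \<pi> (neighbors ?T a)" if "a \<in> verts ?T" for a
      using \<pi> that by (simp add: locally_injective_hom_def)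
    obtain y where y: "y \<in> verts ?T" "y \<in> hop_ball ?T s x" "c y = c z" using s x(1) by blast
    obtain \<phi> where \<phi>: "\<phi> z = y" "\<forall>a\<in>S. \<phi> a \<in> verts ?T \<and> c (\<phi> a) = c a"
      "\<forall>a\<in>S. \<forall>b\<in>S. b \<in> neighbors ?T a \<longrightarrow> \<phi> b \<in> neighbors ?T (\<phi> a)"
      "\<forall>a\<in>S. inj_on \<phi> (neighbors ?T a \<inter> S)"
      using tree_ball_typed_hom[OF T c z y(1,3), of n] unfolding S_def by blast
    \<comment> \<open>The composite is locally injective on \<open>S\<close>: \<open>\<phi>\<close>
      separates neighbours within \<open>S\<close> and sends them to neighbours of one vertex, where
      \<open>\<pi>\<close> separates them again.\<close>
    define \<kappa> where "\<kappa> a = \<pi> (\<phi> a)" for a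
    have \<kappa>V: "\<kappa> ` S \<subseteq> verts G" using \<phi>(2) \<pi>V by (auto simp: \<kappa>_def)
    have \<kappa>_hom: "\<kappa> b \<in> neighbors G (\<kappa> a)" if "a \<in> S" "b \<in> S" "b \<in> neighbors ?T a" for a b
      using \<phi>(3) that \<pi>_hom by (simp add: \<kappa>_def neighbors_def)
    have \<kappa>_inj: "inj_on \<kappa> (neighbors ?T a \<inter> S)" if a: "a \<in> S" for a
    proof (rule inj_onI)
      fix b b' assume b: "b \<in> neighbors ?T a \<inter> S" "b' \<in> neighbors ?T a \<inter> S" "\<kappa> b = \<kappa> b'"
      have "inj_on \<pi> (neighbors ?T (\<phi> a))" using \<pi>_inj \<phi>(2) a by blast
      moreover have "\<phi> b \<in> neighbors ?T (\<phi> a)" "\<phi> b' \<in> neighbors ?T (\<phi> a)" using \<phi>(3) a b by blast+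
      ultimately have "\<phi> b = \<phi> b'" using b(3) unfolding \<kappa>_def by (simp only: inj_on_eq_iff)
      moreover have "inj_on \<phi> (neighbors ?T a \<inter> S)" using \<phi>(4) a by blast
      ultimately show "b = b'" using b(1,2) by (simp only: inj_on_eq_iff)
    qed
    define g where "g = pushforward S \<kappa> f"
    have near: "u \<in> hop_ball G (s + n) v" if "g u \<noteq> 0" for u
    proof -
      have "\<exists>a\<in>S. \<kappa> a = u \<and> f a \<noteq> 0"
        using \<open>g u \<noteq> 0\<close> by (simp only: g_def pushforward_nonzero_iff[OF finS])
      then obtain a where a: "a \<in> S" "\<kappa> a = u" by blast
      have "\<kappa> a \<in> hop_ball G n (\<kappa> z)"
      proof (rule hop_ball_image[where T = ?T and f = \<kappa> and u = a and v = z])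
        show "\<kappa> p \<rightarrow>\<^bsub>G\<^esub> \<kappa> q" if "p \<rightarrow>\<^bsub>?T\<^esub> q" "p \<in> hop_ball ?T n z" "q \<in> hop_ball ?T n z" for p q
          using \<kappa>_hom[of p q] that by (simp add: S_def neighbors_def)
      qed (use a(1) in \<open>simp add: S_def\<close>)
      moreover have "\<pi> y \<in> hop_ball G s (\<pi> x)" by (rule hop_ball_image[where f = \<pi>, OF \<pi>_hom y(2)])
      ultimately show ?thesis
        using a(2) x(2) \<phi>(1) hop_ball_trans[of "\<pi> y" G s v u n] by (simp add: \<kappa>_def)
    qed
    \<comment> \<open>No cancellation can occur in a fibre, so one nonzero value of \<open>f\<close>
      makes the pushforward nonzero.\<close>
    obtain a where "a \<in> S" "f a \<noteq> 0" using f(1) S_def by blast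
    then have "\<exists>b\<in>S. \<kappa> b = \<kappa> a \<and> f b \<noteq> 0" "\<kappa> a \<in> verts G" using \<kappa>V by blast+
    then have "\<exists>u\<in>verts G. g u \<noteq> 0"
      by (intro bexI[of _ "\<kappa> a"]) (simp_all only: g_def pushforward_nonzero_iff[OF finS])
    moreover have "graph_form G g \<ge> ?\<rho> * (\<Sum>u\<in>verts G. (g u)\<^sup>2)"
      using f(2) restricted_form_le_graph_form_pushforward[OF T.sym_digraph_axioms G finS \<kappa>V \<kappa>_hom \<kappa>_inj, of f]
        sum_pushforward_squares[OF finS G.finite_verts \<kappa>V, of f]
      unfolding g_def S_def by simp
    ultimately show "\<exists>g. (\<exists>u\<in>verts G. g u \<noteq> 0) \<and> (\<forall>u. g u \<noteq> 0 \<longrightarrow> u \<in> hop_ball G (s + n) v) \<and>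
        graph_form G g \<ge> ?\<rho> * (\<Sum>u\<in>verts G. (g u)\<^sup>2)"
      using near by blast
  qed
qed

text \<open>The common core of both claims, which differ only in how the set \<open>S\<close> is
  obtained: from the hypothesis on the apart number, or from the degree bound.\<close>

lemma apart_eigenvalue_count:
  fixes D :: "nat mat"
  assumes D: "degree_matrix t D" and \<epsilon>: "\<epsilon> > 0"
  obtains r where "\<And>(G :: ('v, 'e) pre_digraph) S. graph G \<Longrightarrow> subdegree_matrix D G \<Longrightarrow>
    apart (2 * r + 1) G S \<Longrightarrow>
    card S \<le> size {#x \<in># graph_eigenvalues G. x \<ge> graph_rho (universal_cover D) - \<epsilon>#}"
proof -
  let ?\<rho> = "graph_rho (universal_cover D) - \<epsilon>"
  obtain r where r: "\<forall>G :: ('v, 'e) pre_digraph. graph G \<longrightarrow> subdegree_matrix D G \<longrightarrow> (\<forall>v\<in>verts G. \<exists>g.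
    (\<exists>u\<in>verts G. g u \<noteq> 0) \<and> (\<forall>u. g u \<noteq> 0 \<longrightarrow> u \<in> hop_ball G r v) \<and>
    graph_form G g \<ge> ?\<rho> * (\<Sum>u\<in>verts G. (g u)\<^sup>2))"
    using subdegree_matrix_local_test_function[OF D \<epsilon>] by blast
  have "card S \<le> size {#x \<in># graph_eigenvalues G. x \<ge> ?\<rho>#}"
    if G: "graph G" "subdegree_matrix D G" and S: "apart (2 * r + 1) G S"
    for G :: "('v, 'e) pre_digraph" and S
  proof -
    interpret graph G by fact
    have "\<forall>v. \<exists>g. v \<in> verts G \<longrightarrow> (\<exists>u\<in>verts G. g u \<noteq> 0) \<and> (\<forall>u. g u \<noteq> 0 \<longrightarrow> u \<in> hop_ball G r v) \<and>
        graph_form G g \<ge> ?\<rho> * (\<Sum>u\<in>verts G. (g u)\<^sup>2)"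
      using r G by blast
    from choice[OF this] obtain g where "\<And>v. v \<in> verts G \<Longrightarrow> \<exists>u\<in>verts G. g v u \<noteq> 0"
      "\<And>v u. v \<in> verts G \<Longrightarrow> g v u \<noteq> 0 \<Longrightarrow> u \<in> hop_ball G r v"
      "\<And>v. v \<in> verts G \<Longrightarrow> graph_form G (g v) \<ge> ?\<rho> * (\<Sum>u\<in>verts G. (g v u)\<^sup>2)"
      by blast
    moreover have "S \<subseteq> verts G" using S by (simp add: apart_def)
    ultimately show ?thesis
      by (intro card_apart_le_eigenvalue_count[OF S, of g]) blast+
  qed
  then show ?thesis by (rule that)
qed

theorem theorem5p1:
  fixes t :: nat and D :: "nat mat" and \<rho>\<^sub>D :: real
  assumes "degree_matrix t D"
    and "\<rho>\<^sub>D = graph_rho (universal_cover D)"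
  shows
    "(\<forall>\<epsilon>>0. \<exists>r::nat. \<forall>k\<ge>1. \<forall>G :: ('v, 'e) pre_digraph.
        graph G \<and> subdegree_matrix D G \<and> apart_number (2 * r + 1) G \<ge> k \<longrightarrow>
        kth_eigenvalue k G \<ge> \<rho>\<^sub>D - \<epsilon>) \<and>
     (\<forall>\<epsilon>>0. \<forall>\<Delta>::nat. \<Delta> > 0 \<longrightarrow> (\<exists>c::real. c > 0 \<and>
        (\<forall>G :: ('v, 'e) pre_digraph.
           graph G \<and> (\<forall>v\<in>verts G. out_degree G v \<le> \<Delta>) \<and> subdegree_matrix D G \<longrightarrow>
           real (size {#x \<in># graph_eigenvalues G. x > \<rho>\<^sub>D - \<epsilon>#}) \<ge> c * real (card (verts G)))))"
proof (intro conjI allI impI)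
  fix \<epsilon> :: real assume "\<epsilon> > 0"
  then obtain r where r: "\<And>(G :: ('v, 'e) pre_digraph) S. graph G \<Longrightarrow> subdegree_matrix D G \<Longrightarrow>
    apart (2 * r + 1) G S \<Longrightarrow> card S \<le> size {#x \<in># graph_eigenvalues G. x \<ge> \<rho>\<^sub>D - \<epsilon>#}"
    using apart_eigenvalue_count[OF assms(1)] unfolding assms(2) by blast
  have "kth_eigenvalue k G \<ge> \<rho>\<^sub>D - \<epsilon>"
    if "k \<ge> 1" "graph G" "subdegree_matrix D G" "apart_number (2 * r + 1) G \<ge> k"
    for k and G :: "('v, 'e) pre_digraph"
  proof -
    interpret graph G by fact
    obtain S where S: "apart (2 * r + 1) G S" "card S = apart_number (2 * r + 1) G"
      by (rule apart_number_attained)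
    then have "k \<le> size {#x \<in># graph_eigenvalues G. x \<ge> \<rho>\<^sub>D - \<epsilon>#}"
      using r[OF that(2,3) S(1)] that(4) by linarith
    then show ?thesis using \<open>k \<ge> 1\<close> by (intro kth_eigenvalue_ge)
  qed
  then show "\<exists>r::nat. \<forall>k\<ge>1. \<forall>G :: ('v, 'e) pre_digraph.
        graph G \<and> subdegree_matrix D G \<and> apart_number (2 * r + 1) G \<ge> k \<longrightarrow>
        kth_eigenvalue k G \<ge> \<rho>\<^sub>D - \<epsilon>" by blast
next
  fix \<epsilon> :: real and \<Delta> :: nat assume "\<epsilon> > 0"
  \<comment> \<open>The count concerns eigenvalues at or above a threshold; halving \<epsilon> turns
    this into the strict inequality.\<close>
  then have "\<epsilon> / 2 > 0" by simp
  then obtain r where r: "\<And>(G :: ('v, 'e) pre_digraph) S. graph G \<Longrightarrow> subdegree_matrix D G \<Longrightarrow>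
    apart (2 * r + 1) G S \<Longrightarrow> card S \<le> size {#x \<in># graph_eigenvalues G. x \<ge> \<rho>\<^sub>D - \<epsilon> / 2#}"
    using apart_eigenvalue_count[OF assms(1)] unfolding assms(2) by blast
  \<comment> \<open>An upper bound for the size of a ball of radius \<open>2 * r + 1\<close>; its
    reciprocal is the constant \<open>c\<close>.\<close>
  define N where "N = Suc \<Delta> ^ (2 * r + 1)"
  have N: "N > 0" by (simp add: N_def)
  have "real (size {#x \<in># graph_eigenvalues G. x > \<rho>\<^sub>D - \<epsilon>#}) \<ge> 1 / N * real (card (verts G))"
    if G: "graph G" "\<forall>v\<in>verts G. out_degree G v \<le> \<Delta>" "subdegree_matrix D G"
    for G :: "('v, 'e) pre_digraph"
  proof -
    interpret graph G by fact
    obtain S where S: "apart (2 * r + 1) G S" "card (verts G) \<le> card S * N"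
      using card_verts_le_apart[of \<Delta> "2 * r + 1"] G(2) unfolding N_def by blast
    have "card S \<le> size {#x \<in># graph_eigenvalues G. x \<ge> \<rho>\<^sub>D - \<epsilon> / 2#}" using r G(1,3) S(1) by blast
    also have "\<dots> \<le> size {#x \<in># graph_eigenvalues G. x > \<rho>\<^sub>D - \<epsilon>#}"
      using \<open>\<epsilon> > 0\<close> by (intro size_mset_mono filter_mset_mono_strong) auto
    finally have "card S * N \<le> size {#x \<in># graph_eigenvalues G. x > \<rho>\<^sub>D - \<epsilon>#} * N"
      by (rule mult_le_mono1)
    then have "card (verts G) \<le> size {#x \<in># graph_eigenvalues G. x > \<rho>\<^sub>D - \<epsilon>#} * N"
      using S(2) by linarith
    then have "real (card (verts G)) \<le> real (size {#x \<in># graph_eigenvalues G. x > \<rho>\<^sub>D - \<epsilon>#}) * real N"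
      by (metis of_nat_le_iff of_nat_mult)
    then show ?thesis using N by (simp add: field_simps)
  qed
  moreover have "1 / real N > 0" using N by simp
  ultimately show "\<exists>c::real. c > 0 \<and> (\<forall>G :: ('v, 'e) pre_digraph.
      graph G \<and> (\<forall>v\<in>verts G. out_degree G v \<le> \<Delta>) \<and> subdegree_matrix D G \<longrightarrow>
      real (size {#x \<in># graph_eigenvalues G. x > \<rho>\<^sub>D - \<epsilon>#}) \<ge> c * real (card (verts G)))"
    by blast
qed

end
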